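(* Let $0<b\le a$ be fixed and $t>0$. For integers $1\le m\le n$ let $\Omega_{m,n,[b^2,a^2]}$ be the set of all weight functions $\omega:\{1,\dots,m\}\times\{1,\dots,n\}\to[b^2,a^2]$, and for such $\omega$ let $K_{m,n,\omega}$ be the complete bipartite graph with parts of sizes $m$ and $n$ weighted by $\omega$. Let $C(\omega)=[\sqrt{\omega(i,j)}]\in\mathbb{R}^{m\times n}$ and $A=A(\omega)=\begin{pmatrix}0&C(\omega)\\-C(\omega)^\top&0\end{pmatrix}\in\mathbb{R}^{N\times N}$, $N=m+n$. Let $x_{ij}$, $1\le i\le j\le N$, be independent real Gaussian random variables with mean $0$ and variance $1$, $Y_A=[a_{ij}x_{\min(i,j)\max(i,j)}]_{i,j=1}^N$, and define $\tilde\Phi(t,K_{m,n,\omega})$ by $\log\tilde\Phi(t,K_{m,n,\omega})=\mathbb{E}\log\det(\sqrt tI_N+Y_A)$. Then for every $\delta>0$, $$\limsup_{n\to\infty}\ \sup_{m\le n,\ \omega\in\Omega_{m,n,[b^2,a^2]}}\Pr\Big(\frac{1}{m+n}\big|\log\det(\sqrt tI_N+Y_A)-\log\Phi(t,K_{m,n,\omega})\big|>\delta\Big)=0,$$ and equivalently $$\limsup_{n\to\infty}\ \sup_{m\le n,\ \omega\in\Omega_{m,n,[b^2,a^2]}}\frac{1}{m+n}\Big(\log\Phi(t,K_{m,n,\omega})-\log\tilde\Phi(t,K_{m,n,\omega})\Big)=0.$$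
   Context: For a weighted graph $G_\omega$ on $N$ vertices: a $k$-matching is a set of $k$ pairwise vertex-disjoint edges; $\phi(k,G_\omega)=\sum_M\prod_{e\in M}\omega(e)$ over all $k$-matchings $M$ (zero if none), $\phi(0,G_\omega)=1$; $\Phi(t,G_\omega)=\sum_{k=0}^{n'}\phi(k,G_\omega)t^{n'-k}$ with $n'=\lfloor N/2\rfloor$. *)

theory Defs
  imports "HOL-Probability.Probability" "Jordan_Normal_Form.Determinant"
begin

text \<open>A weighted graph is given by a finite vertex set V, an edge set E of
  2-element subsets of V, and a weight function w on edges.\<close>

definition matchings :: "'v set set \<Rightarrow> nat \<Rightarrow> 'v set set set" where
  "matchings E k = {M. M \<subseteq> E \<and> finite M \<and> card M = k \<and>
      (\<forall>e1\<in>M. \<forall>e2\<in>M. e1 \<noteq> e2 \<longrightarrow> e1 \<inter> e2 = {})}"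

definition match_phi :: "'v set set \<Rightarrow> ('v set \<Rightarrow> real) \<Rightarrow> nat \<Rightarrow> real" where
  "match_phi E w k = (\<Sum>M\<in>matchings E k. \<Prod>e\<in>M. w e)"

definition match_Phi :: "'v set \<Rightarrow> 'v set set \<Rightarrow> ('v set \<Rightarrow> real) \<Rightarrow> real \<Rightarrow> real" where
  "match_Phi V E w t = (\<Sum>k=0..card V div 2. match_phi E w k * t ^ (card V div 2 - k))"

text \<open>Vertices 0..<m+n; left vertex i (1<=i<=m) is i-1, right vertex j (1<=j<=n) is m+j-1.
  The weight omega is indexed as in the paper: omega i j for 1<=i<=m, 1<=j<=n.\<close>

definition Kmn_V :: "nat \<Rightarrow> nat \<Rightarrow> nat set" where
  "Kmn_V m n = {0..<m+n}"

definition Kmn_E :: "nat \<Rightarrow> nat \<Rightarrow> nat set set" where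
  "Kmn_E m n = {{i - 1, m + j - 1} | i j. 1 \<le> i \<and> i \<le> m \<and> 1 \<le> j \<and> j \<le> n}"

definition Kmn_w :: "nat \<Rightarrow> (nat \<Rightarrow> nat \<Rightarrow> real) \<Rightarrow> nat set \<Rightarrow> real" where
  "Kmn_w m \<omega> e = \<omega> (Min e + 1) (Max e + 1 - m)"

definition Phi_K :: "nat \<Rightarrow> nat \<Rightarrow> (nat \<Rightarrow> nat \<Rightarrow> real) \<Rightarrow> real \<Rightarrow> real" where
  "Phi_K m n \<omega> t = match_Phi (Kmn_V m n) (Kmn_E m n) (Kmn_w m \<omega>) t"

text \<open>Omega_{m,n,[lo,hi]}: weights on {1..m} x {1..n} with values in [lo,hi]
  (values outside this index range are irrelevant).\<close>
definition weights_in :: "nat \<Rightarrow> nat \<Rightarrow> real \<Rightarrow> real \<Rightarrow> (nat \<Rightarrow> nat \<Rightarrow> real) \<Rightarrow> bool" where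
  "weights_in m n lo hi \<omega> \<longleftrightarrow> (\<forall>i\<in>{1..m}. \<forall>j\<in>{1..n}. \<omega> i j \<in> {lo..hi})"

text \<open>Entries (0-indexed) of A = [[0, C], [-C^T, 0]] with C(i,j) = sqrt(omega i j).\<close>
definition A_entry :: "nat \<Rightarrow> (nat \<Rightarrow> nat \<Rightarrow> real) \<Rightarrow> nat \<Rightarrow> nat \<Rightarrow> real" where
  "A_entry m \<omega> r c =
     (if r < m \<and> m \<le> c then sqrt (\<omega> (r + 1) (c + 1 - m))
      else if c < m \<and> m \<le> r then - sqrt (\<omega> (c + 1) (r + 1 - m))
      else 0)"

definition A_mat :: "nat \<Rightarrow> nat \<Rightarrow> (nat \<Rightarrow> nat \<Rightarrow> real) \<Rightarrow> real mat" where
  "A_mat m n \<omega> = mat (m + n) (m + n) (\<lambda>(r, c). A_entry m \<omega> r c)"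

definition gauss_idx :: "nat \<Rightarrow> (nat \<times> nat) set" where
  "gauss_idx N = {(i, j). i \<le> j \<and> j < N}"

definition gauss_space :: "nat \<Rightarrow> ((nat \<times> nat) \<Rightarrow> real) measure" where
  "gauss_space N = (\<Pi>\<^sub>M p\<in>gauss_idx N. density lborel std_normal_density)"

definition Y_mat :: "real mat \<Rightarrow> ((nat \<times> nat) \<Rightarrow> real) \<Rightarrow> real mat" where
  "Y_mat A x = mat (dim_row A) (dim_col A) (\<lambda>(i, j). A $$ (i, j) * x (min i j, max i j))"

definition logdet_rand :: "nat \<Rightarrow> nat \<Rightarrow> (nat \<Rightarrow> nat \<Rightarrow> real) \<Rightarrow> real \<Rightarrow> ((nat \<times> nat) \<Rightarrow> real) \<Rightarrow> real" where
  "logdet_rand m n \<omega> t x =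
     ln (Determinant.det (sqrt t \<cdot>\<^sub>m 1\<^sub>m (m + n) + Y_mat (A_mat m n \<omega>) x))"

definition Phi_tilde :: "nat \<Rightarrow> nat \<Rightarrow> (nat \<Rightarrow> nat \<Rightarrow> real) \<Rightarrow> real \<Rightarrow> real" where
  "Phi_tilde m n \<omega> t = exp (\<integral>x. logdet_rand m n \<omega> t x \<partial>gauss_space (m + n))"

end

theory Submission
  imports Defs
begin

text \<open>
  Let \<open>C\<close> be the random \<open>m \<times> n\<close> block of \<open>Y\<close> with columns \<open>c\<^sub>j\<close>, and \<open>S = t I + C C\<^sup>T\<close>. Then
  \<open>det (\<surd>t I + Y) = t\<^bsup>(n-m)/2\<^esup> det S\<close>, and by the Leibniz formula its expectation is \<open>\<Phi>\<close> up to a factor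
  \<open>\<surd>t\<close>. So everything reduces to showing that the Jensen gap \<open>ln (E det S) - E (ln det S)\<close> is \<open>o(n)\<close>
  uniformly; deviations of \<open>ln det S\<close> are then controlled by the gap and Markov's inequality.

  If \<open>Q\<close> is positive semidefinite with norm at most \<open>r\<close> and \<open>q = y\<^sup>T Q y\<close> for a standard Gaussian \<open>y\<close>, a second
  moment computation gives \<open>E (1 / (1 + q)) \<le> (1 + 2 r) / (1 + tr Q)\<close>, hence also
  \<open>ln (1 + tr Q) \<le> E (ln (1 + q)) + 2 r\<close>. As a function of one column, \<open>det S\<close> averaged over the other
  columns is a constant times such a \<open>1 + q\<close> with \<open>r \<le> a\<^sup>2 / t\<close>, so revealing the columns one at a time bounds
  the gap by \<open>2 n a\<^sup>2 / t\<close>. This is small compared to \<open>n\<close> only for large \<open>t\<close>, so \<open>t\<close> is first replaced by a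
  large constant \<open>T\<close>. The price is \<open>(T - t) E (tr S\<inverse>)\<close>, and the first inequality, applied to each column
  given the others, yields \<open>E (tr S\<inverse>)\<^sup>2 = O(n)\<close>; here the lower bound \<open>b\<close> on the weights enters.
\<close>

section \<open>Determinants and rank-one updates\<close>

text \<open>The trace of the inverse is always at most \<open>m / t\<close>, but this alone would
  make the passage from \<open>t\<close> to \<open>T\<close> cost a multiple of \<open>n\<close>. A
  second moment of order \<open>n\<close> lowers the cost to a multiple of \<open>sqrt n\<close> for
  each fixed \<open>T\<close>, so \<open>T\<close> is chosen from the wanted accuracy first and
  \<open>n\<close> grows afterwards. It is the second moment because an exact identity is multiplied
  by the trace: the sum over the columns of \<open>1 / (1 + q j)\<close> is \<open>n - m\<close>
  plus \<open>t\<close> times the trace, and a factor 1 plus \<open>b * b\<close> times the trace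
  keeps the expectation of each summand below a constant. As \<open>m \<le> n\<close>, the term
  \<open>n - m\<close> only helps. All bounds depend on \<open>a\<close>, \<open>b\<close>,
  \<open>t\<close>, \<open>T\<close> and \<open>n\<close> alone, whence the uniformity in
  \<open>m\<close> and the weights. The expected determinant is a matching sum without signs because
  \<open>A\<close> is skew-symmetric: an involution with \<open>k\<close> transpositions has sign
  \<open>(-1)^k\<close>, and the entries of \<open>A\<close> contribute the same sign once more.
  Both claims follow from one estimate of the mean of \<open>|ln det - ln \<Phi>|\<close>.\<close>

lemma det_one_plus_outer:
  fixes u v :: "nat \<Rightarrow> real"
  shows "Determinant.det (mat m m (\<lambda>(i, k). (if i = k then 1 else 0) + u i * v k)) = 1 + (\<Sum>i<m. v i * u i)"
proof -
  define U where "U = mat m 1 (\<lambda>(i, k::nat). u i)"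
  define V where "V = mat 1 m (\<lambda>(i::nat, k). v k)"
  \<comment> \<open>\<open>P\<close> and \<open>L\<close> are chosen so that \<open>P * L\<close>
    and \<open>L * P\<close> are both block triangular, with diagonal blocks
    \<open>1, V U + 1\<close> and \<open>1 + U V, 1\<close>. Comparing the two determinants reduces
    an \<open>m\<close>-dimensional determinant to a scalar.\<close>
  define P where "P = four_block_mat (1\<^sub>m m) (- U) V (1\<^sub>m 1)"
  define L where "L = four_block_mat (1\<^sub>m m) U (0\<^sub>m 1 m) (1\<^sub>m 1)"
  have U[simp]: "U \<in> carrier_mat m 1" and V[simp]: "V \<in> carrier_mat 1 m"
    unfolding U_def V_def by (rule mat_carrier)+
  note [simp] = U[unfolded One_nat_def] V[unfolded One_nat_def]
  have P[simp]: "P \<in> carrier_mat (m + 1) (m + 1)" and L[simp]: "L \<in> carrier_mat (m + 1) (m + 1)"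
    by (auto simp: P_def L_def)
  have uz: "- U * 0\<^sub>m 1 m = 0\<^sub>m m m" "- U * 1\<^sub>m 1 = - U" "V * 1\<^sub>m m = V"
    by (rule right_mult_zero_mat[of _ m], simp, rule right_mult_one_mat[of _ m], simp,
        rule right_mult_one_mat[of _ 1], simp)
  have uz': "V + 0\<^sub>m 1 m = V" "U + - U = 0\<^sub>m m 1" "- U + U = 0\<^sub>m m 1"
      "0\<^sub>m 1 m + V = V" "U * 1\<^sub>m 1 = U" "1\<^sub>m 1 * V = V" "0\<^sub>m 1 m * - U = 0\<^sub>m 1 1"
      "0\<^sub>m 1 1 + 1\<^sub>m 1 = (1\<^sub>m 1 :: real mat)"
    by ((rule eq_matI; auto simp: U_def V_def scalar_prod_def mult_delta_left mult_delta_right sum.delta; fail)+)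
  note [simp] = uz[unfolded One_nat_def] uz'[unfolded One_nat_def]
  have "P * L = four_block_mat (1\<^sub>m m) (0\<^sub>m m 1) V (V * U + 1\<^sub>m 1)"
    unfolding P_def L_def
    by (subst mult_four_block_mat[of _ m m _ 1 _ 1 _ _ m _ 1])
       (auto simp: right_mult_zero_mat[of _ _ 1] left_mult_one_mat[of _ m 1] intro!: cong_four_block_mat)
  then have "Determinant.det (P * L) = Determinant.det (V * U + 1\<^sub>m 1)"
    by (subst (asm) eq_commute) (auto dest!: arg_cong[where f=Determinant.det] simp: det_four_block_mat_upper_right_zero[of _ m _ 1])
  moreover have "L * P = four_block_mat (1\<^sub>m m + U * V) (0\<^sub>m m 1) V (1\<^sub>m 1)"
    unfolding P_def L_def
    by (subst mult_four_block_mat[of _ m m _ 1 _ 1 _ _ m _ 1])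
       (auto simp: right_mult_zero_mat[of _ _ 1] left_mult_one_mat[of _ m 1] intro!: cong_four_block_mat)
  then have "Determinant.det (L * P) = Determinant.det (1\<^sub>m m + U * V)"
    by (simp only:) (rule trans[OF det_four_block_mat_upper_right_zero[of _ m _ 1]],
        auto intro!: add_carrier_mat mult_carrier_mat[of U m 1 V m])
  moreover have "Determinant.det (P * L) = Determinant.det (L * P)"
    by (simp add: det_mult[OF P L] det_mult[OF L P])
  ultimately have "Determinant.det (1\<^sub>m m + U * V) = Determinant.det (V * U + 1\<^sub>m 1)"
    by simp
  moreover have "1\<^sub>m m + U * V = mat m m (\<lambda>(i, k). (if i = k then 1 else 0) + u i * v k)"
    by (auto simp: U_def V_def scalar_prod_def)
  moreover have "V * U + 1\<^sub>m 1 = mat 1 1 (\<lambda>_. 1 + (\<Sum>i<m. v i * u i))"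
    by (auto simp: U_def V_def scalar_prod_def lessThan_atLeast0)
  moreover have "Determinant.det (mat 1 1 (\<lambda>_. 1 + (\<Sum>i<m. v i * u i))) = 1 + (\<Sum>i<m. v i * u i)"
    by (simp add: det_single)
  ultimately show ?thesis by metis
qed

text \<open>Right multiplication by \<open>L\<close> clears the lower left block and leaves
  \<open>s\<^sup>2 I + C C^T\<close> in the upper left one. The factor \<open>s ^ m\<close> is the
  determinant of \<open>L\<close>; it is cancelled only later, where \<open>m \<le> n\<close> and
  \<open>0 < s\<close> are at hand.\<close>

lemma det_bipartite_block:
  fixes B :: "nat \<Rightarrow> nat \<Rightarrow> real"
  shows "s ^ m * Determinant.det (mat (m + n) (m + n) (\<lambda>(i, k).
      if i = k then s else if i < m \<and> m \<le> k then B i k else if k < m \<and> m \<le> i then - B k i else 0))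
    = s ^ n * Determinant.det (mat m m (\<lambda>(i, k). (if i = k then s\<^sup>2 else 0) + (\<Sum>j\<in>{m..<m+n}. B i j * B k j)))"
    (is "_ * Determinant.det ?M = _ * Determinant.det ?G")
proof -
  define C where "C = mat m n (\<lambda>(i, k). B i (m + k))"
  define L where "L = four_block_mat (s \<cdot>\<^sub>m 1\<^sub>m m) (0\<^sub>m m n) (transpose_mat C) (1\<^sub>m n)"
  have C[simp]: "C \<in> carrier_mat m n" by (simp add: C_def)
  have M: "?M = four_block_mat (s \<cdot>\<^sub>m 1\<^sub>m m) C (- transpose_mat C) (s \<cdot>\<^sub>m 1\<^sub>m n)"
    by (rule eq_matI) (auto simp: C_def)
  have L[simp]: "L \<in> carrier_mat (m + n) (m + n)" by (simp add: L_def)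
  have sum_shift: "(\<Sum>j\<in>{m..<m+n}. g j) = (\<Sum>k = 0..<n. g (m + k))" for g :: "nat \<Rightarrow> real"
    using sum.shift_bounds_nat_ivl[of g 0 m n] by (simp add: add.commute)
  have "s \<cdot>\<^sub>m 1\<^sub>m m * (s \<cdot>\<^sub>m 1\<^sub>m m) = s\<^sup>2 \<cdot>\<^sub>m (1\<^sub>m m :: real mat)"
    by (simp add: mult_smult_assoc_mat[of _ m m _ m] power2_eq_square) (rule eq_matI, auto)
  then have e1: "s \<cdot>\<^sub>m 1\<^sub>m m * (s \<cdot>\<^sub>m 1\<^sub>m m) + C * transpose_mat C = ?G"
    by (intro eq_matI) (auto simp: C_def scalar_prod_def sum_shift)
  have e2: "- transpose_mat C * (s \<cdot>\<^sub>m 1\<^sub>m m) + s \<cdot>\<^sub>m 1\<^sub>m n * transpose_mat C = 0\<^sub>m n m"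
    by (intro eq_matI) (auto simp: C_def scalar_prod_def mult_delta_right sum.delta mult_delta_left)
  have [simp]: "C * 1\<^sub>m n = C" "0\<^sub>m m n + C = C" "- transpose_mat C * 0\<^sub>m m n = 0\<^sub>m n n"
      "0\<^sub>m n n + s \<cdot>\<^sub>m 1\<^sub>m n = s \<cdot>\<^sub>m 1\<^sub>m n"
    by (rule right_mult_one_mat[of _ m], simp, rule left_add_zero_mat, simp,
        rule right_mult_zero_mat[of _ n], simp, rule left_add_zero_mat[of _ n n], simp)
  have "?M * L = four_block_mat ?G C (0\<^sub>m n m) (s \<cdot>\<^sub>m 1\<^sub>m n)"
    unfolding M L_def e1[symmetric] e2[symmetric]
    by (subst mult_four_block_mat[of _ m m _ n _ n _ _ m _ n]) (auto intro!: cong_four_block_mat)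
  then have "Determinant.det (?M * L) = Determinant.det ?G * s ^ n"
    by (simp add: det_four_block_mat_lower_left_zero[of _ m _ n])
  moreover have "Determinant.det (?M * L) = Determinant.det ?M * Determinant.det L"
    by (rule det_mult[OF _ L]) simp
  moreover have "Determinant.det L = s ^ m"
    unfolding L_def by (subst det_four_block_mat_upper_right_zero[of _ m _ n]) auto
  ultimately show ?thesis by (simp add: mult.commute)
qed

text \<open>Matrices are kept as functions of two indices, of which only those below
  \<open>m\<close> count. Random entries, updates and rescalings then carry no dimension
  conditions.\<close>

definition fdet :: "nat \<Rightarrow> (nat \<Rightarrow> nat \<Rightarrow> real) \<Rightarrow> real" where
  "fdet m S = Determinant.det (mat m m (\<lambda>(i, k). S i k))"

definition qform :: "nat \<Rightarrow> (nat \<Rightarrow> nat \<Rightarrow> real) \<Rightarrow> (nat \<Rightarrow> real) \<Rightarrow> real" where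
  "qform m Q v = (\<Sum>i<m. \<Sum>k<m. Q i k * v i * v k)"

definition rank1 :: "(nat \<Rightarrow> real) \<Rightarrow> nat \<Rightarrow> nat \<Rightarrow> real" where
  "rank1 c i k = c i * c k"

definition rank1_update :: "(nat \<Rightarrow> nat \<Rightarrow> real) \<Rightarrow> (nat \<Rightarrow> real) \<Rightarrow> nat \<Rightarrow> nat \<Rightarrow> real" where
  "rank1_update S c i k = S i k + c i * c k"

definition sym_on :: "nat \<Rightarrow> (nat \<Rightarrow> nat \<Rightarrow> real) \<Rightarrow> bool" where
  "sym_on m Q \<longleftrightarrow> (\<forall>i<m. \<forall>k<m. Q i k = Q k i)"

text \<open>The Loewner order \<open>0 \<le> Q \<le> r I\<close>, expressed by quadratic forms: in
  this shape it passes to averages of matrices, and no eigenvalues have to be introduced.\<close>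

definition psd_le :: "nat \<Rightarrow> real \<Rightarrow> (nat \<Rightarrow> nat \<Rightarrow> real) \<Rightarrow> bool" where
  "psd_le m r Q \<longleftrightarrow> sym_on m Q \<and> (\<forall>v. 0 \<le> qform m Q v \<and> qform m Q v \<le> r * (\<Sum>i<m. (v i)\<^sup>2))"

definition inverse_pair :: "nat \<Rightarrow> (nat \<Rightarrow> nat \<Rightarrow> real) \<Rightarrow> (nat \<Rightarrow> nat \<Rightarrow> real) \<Rightarrow> bool" where
  "inverse_pair m S R \<longleftrightarrow> (\<forall>i<m. \<forall>k<m. (\<Sum>l<m. S i l * R l k) = (if i = k then 1 else 0))"

definition evec :: "nat \<Rightarrow> nat \<Rightarrow> real" where
  "evec i l = (if l = i then 1 else 0)"

text \<open>The entries of the inverse, read off by polarisation from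
  \<open>fdet m (S + c c\<^sup>T) = fdet m S * (1 + c\<^sup>T S\<inverse> c)\<close>; meaningful only for invertible symmetric \<open>S\<close>.
  This form makes uniqueness and measurability in \<open>S\<close> immediate.\<close>

definition minv :: "nat \<Rightarrow> (nat \<Rightarrow> nat \<Rightarrow> real) \<Rightarrow> nat \<Rightarrow> nat \<Rightarrow> real" where
  "minv m S i k = (fdet m (rank1_update S (\<lambda>l. evec i l + evec k l)) - fdet m (rank1_update S (evec i))
     - fdet m (rank1_update S (evec k)) + fdet m S) / (2 * fdet m S)"

section \<open>Quadratic forms, Cauchy-Schwarz and the Loewner order\<close>

lemma qform_cong: "(\<And>i k. i < m \<Longrightarrow> k < m \<Longrightarrow> Q i k = Q' i k) \<Longrightarrow> (\<And>i. i < m \<Longrightarrow> v i = v' i) \<Longrightarrow> qform m Q v = qform m Q' v'"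
  unfolding qform_def by (intro sum.cong refl) auto

lemma fdet_cong: "(\<And>i k. i < m \<Longrightarrow> k < m \<Longrightarrow> S i k = S' i k) \<Longrightarrow> fdet m S = fdet m S'"
  unfolding fdet_def by (rule arg_cong[where f=Determinant.det], rule eq_matI) auto

lemma qform_add: "qform m (\<lambda>i k. Q i k + Q' i k) v = qform m Q v + qform m Q' v"
  unfolding qform_def by (simp add: sum.distrib algebra_simps)

lemma qform_scale: "qform m (\<lambda>i k. r * Q i k) v = r * qform m Q v"
  unfolding qform_def by (simp add: sum_distrib_left algebra_simps)

lemma qform_scale_vec: "qform m Q (\<lambda>i. s * v i) = s\<^sup>2 * qform m Q v"
  unfolding qform_def by (simp add: sum_distrib_left power2_eq_square algebra_simps)

lemma qform_rank1: "qform m (rank1 u) v = (\<Sum>i<m. u i * v i)\<^sup>2"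
  unfolding qform_def rank1_def power2_eq_square sum_product by (simp add: algebra_simps)

lemma qform_eq_inner: "qform m Q v = (\<Sum>i<m. v i * (\<Sum>k<m. Q i k * v k))"
  unfolding qform_def by (simp add: sum_distrib_left algebra_simps)

lemma sum_evec: "i < m \<Longrightarrow> (\<Sum>l<m. f l * evec i l) = f i" "i < m \<Longrightarrow> (\<Sum>l<m. evec i l * f l) = f i"
  unfolding evec_def by (simp_all add: mult_delta_right mult_delta_left sum.delta)

lemma qform_evec: "i < m \<Longrightarrow> qform m Q (evec i) = Q i i"
  unfolding qform_eq_inner by (simp add: sum_evec)

lemma qform_evec_add:
  assumes "i < m" "k < m"
  shows "qform m Q (\<lambda>l. evec i l + evec k l) = Q i i + Q i k + Q k i + Q k k"
  unfolding qform_eq_inner using assms by (simp add: sum_evec sum.distrib distrib_left distrib_right)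

lemma qform_add_vec:
  assumes "sym_on m Q"
  shows "qform m Q (\<lambda>i. v i + s * w i) = qform m Q v + 2 * s * (\<Sum>i<m. w i * (\<Sum>k<m. Q i k * v k)) + s\<^sup>2 * qform m Q w"
proof -
  have *: "(\<Sum>i<m. \<Sum>k<m. Q i k * v i * w k) = (\<Sum>i<m. \<Sum>k<m. Q i k * w i * v k)"
    by (subst sum.swap) (use assms in \<open>auto intro!: sum.cong simp: sym_on_def\<close>)
  have "qform m Q (\<lambda>i. v i + s * w i) = qform m Q v + s * (\<Sum>i<m. \<Sum>k<m. Q i k * v i * w k)
      + s * (\<Sum>i<m. \<Sum>k<m. Q i k * w i * v k) + s\<^sup>2 * qform m Q w"
    unfolding qform_def by (simp add: sum_distrib_left sum.distrib[symmetric] algebra_simps power2_eq_square)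
  moreover have "(\<Sum>i<m. \<Sum>k<m. Q i k * w i * v k) = (\<Sum>i<m. w i * (\<Sum>k<m. Q i k * v k))"
    by (simp add: sum_distrib_left algebra_simps)
  ultimately show ?thesis unfolding * by simp
qed

text \<open>Discriminant argument: the form at \<open>v + s w\<close> is a nonnegative polynomial in
  \<open>s\<close>, evaluated at its minimiser. If the form vanishes at \<open>w\<close> the
  polynomial is affine and that case is treated apart.\<close>

lemma psd_cauchy_schwarz:
  assumes Q: "psd_le m r Q"
  shows "(\<Sum>i<m. w i * (\<Sum>k<m. Q i k * v k))\<^sup>2 \<le> qform m Q w * qform m Q v"
proof -
  define B where "B = (\<Sum>i<m. w i * (\<Sum>k<m. Q i k * v k))"
  have sym: "sym_on m Q" and nn: "\<And>v. 0 \<le> qform m Q v" using Q by (auto simp: psd_le_def)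
  have *: "0 \<le> qform m Q v + 2 * s * B + s\<^sup>2 * qform m Q w" for s
    using nn[of "\<lambda>i. v i + s * w i"] unfolding qform_add_vec[OF sym] B_def .
  show ?thesis
  proof (cases "qform m Q w = 0")
    case True
    have "B = 0"
    proof (rule ccontr)
      assume "B \<noteq> 0"
      \<comment> \<open>At this \<open>s\<close> the affine function takes the value -1.\<close>
      then show False using *[of "- (qform m Q v + 1) / (2 * B)"] True by (simp add: field_simps)
    qed
    then show ?thesis using True B_def by simp
  next
    case False
    with nn[of w] have pos: "qform m Q w > 0" by simp
    have "0 \<le> (qform m Q v + 2 * (- B / qform m Q w) * B + (- B / qform m Q w)\<^sup>2 * qform m Q w) * qform m Q w"
      using *[of "- B / qform m Q w"] pos by simp
    also have "\<dots> = qform m Q w * qform m Q v - B\<^sup>2"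
      using pos by (simp add: field_simps power2_eq_square)
    finally show ?thesis unfolding B_def by simp
  qed
qed

lemma psd_diag:
  assumes "psd_le m r Q" "i < m"
  shows "0 \<le> Q i i" "Q i i \<le> r"
proof -
  have "(\<Sum>l<m. (evec i l)\<^sup>2) = 1"
    using assms sum_evec(1)[of i m "evec i"] by (simp add: power2_eq_square evec_def)
  then show "0 \<le> Q i i" "Q i i \<le> r"
    using assms qform_evec[of i m Q] unfolding psd_le_def by (metis mult.right_neutral)+
qed

text \<open>The diagonal of \<open>Q Q \<le> r Q\<close>. Cauchy-Schwarz between row
  \<open>i\<close> and a basis vector bounds the squared row sum by \<open>r\<close> times that sum
  times \<open>Q i i\<close>, and one factor cancels. Summed over \<open>i\<close>, this bounds the
  variance of a Gaussian form by its trace.\<close>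

lemma psd_row_norm:
  assumes Q: "psd_le m r Q" and "i < m"
  shows "(\<Sum>k<m. (Q i k)\<^sup>2) \<le> r * Q i i"
proof -
  let ?w = "\<lambda>k. Q i k"
  define s where "s = (\<Sum>k<m. (Q i k)\<^sup>2)"
  have sym: "sym_on m Q" using Q by (simp add: psd_le_def)
  have s0: "0 \<le> s" unfolding s_def by (intro sum_nonneg) simp
  have "(\<Sum>j<m. ?w j * (\<Sum>k<m. Q j k * evec i k)) = s"
    unfolding s_def using assms sym by (auto simp: sum_evec power2_eq_square sym_on_def intro!: sum.cong)
  then have "s\<^sup>2 \<le> qform m Q ?w * qform m Q (evec i)"
    using psd_cauchy_schwarz[OF Q, of ?w "evec i"] by simp
  also have "\<dots> \<le> (r * s) * qform m Q (evec i)"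
    unfolding s_def using Q by (intro mult_right_mono) (auto simp: psd_le_def)
  finally have "s * s \<le> s * (r * Q i i)"
    using assms by (simp add: qform_evec power2_eq_square algebra_simps)
  moreover have "0 \<le> r * Q i i" using psd_diag[OF assms] by simp
  ultimately show ?thesis using s0 unfolding s_def[symmetric]
    by (metis antisym_conv2 mult_le_cancel_left_pos)
qed

lemma psd_frobenius:
  assumes Q: "psd_le m r Q"
  shows "(\<Sum>i<m. \<Sum>k<m. (Q i k)\<^sup>2) \<le> r * (\<Sum>i<m. Q i i)"
  unfolding sum_distrib_left by (intro sum_mono psd_row_norm[OF Q]) simp

lemma inverse_pair_apply:
  assumes "inverse_pair m S R" and "i < m"
  shows "(\<Sum>l<m. S i l * (\<Sum>k<m. R l k * c k)) = c i"
proof -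
  have "(\<Sum>l<m. S i l * (\<Sum>k<m. R l k * c k)) = (\<Sum>l<m. \<Sum>k<m. S i l * R l k * c k)"
    by (simp add: sum_distrib_left mult.assoc)
  also have "\<dots> = (\<Sum>k<m. (\<Sum>l<m. S i l * R l k) * c k)"
    by (subst sum.swap) (simp add: sum_distrib_right)
  also have "\<dots> = (\<Sum>k<m. (if i = k then 1 else 0) * c k)"
    using assms by (intro sum.cong) (auto simp: inverse_pair_def)
  also have "\<dots> = c i" using assms by (simp add: mult_delta_left sum.delta)
  finally show ?thesis .
qed

text \<open>Factor \<open>S + c c^T = S (I + (R c) c^T)\<close>; the second factor is the identity
  plus an outer product.\<close>

lemma fdet_add_rank1:
  assumes "inverse_pair m S R" and "sym_on m R"
  shows "fdet m (rank1_update S c) = fdet m S * (1 + qform m R c)"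
proof -
  define u where "u i = (\<Sum>k<m. R i k * c k)" for i
  have Su: "(\<Sum>l<m. S i l * u l) = c i" if "i < m" for i
    unfolding u_def by (rule inverse_pair_apply[OF assms(1) that])
 have "mat m m (\<lambda>(i, k). (rank1_update S c) i k) = mat m m (\<lambda>(i, k). S i k)
      * mat m m (\<lambda>(i, k). (if i = k then 1 else 0) + u i * c k)"
  proof (rule eq_matI, goal_cases)
    case (1 i k)
    then have "(\<Sum>l = 0..<m. S i l * ((if l = k then 1 else 0) + u l * c k)) = S i k + (\<Sum>l<m. S i l * u l) * c k"
      by (simp add: distrib_left sum.distrib mult_delta_right sum.delta sum_distrib_right lessThan_atLeast0 mult.assoc)
    then show ?case using 1 Su by (simp add: scalar_prod_def rank1_update_def)
  qed auto
  then have "fdet m (rank1_update S c) = fdet m S * (1 + (\<Sum>i<m. c i * u i))"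
    unfolding fdet_def by (subst det_one_plus_outer[symmetric]) (simp add: det_mult[of _ m])
  then show ?thesis unfolding qform_eq_inner u_def .
qed

lemma minv_eqI:
  assumes "inverse_pair m S R" "sym_on m R" "fdet m S \<noteq> 0" "i < m" "k < m"
  shows "minv m S i k = R i k"
proof -
  have "R k i = R i k" using assms by (auto simp: sym_on_def)
  then show ?thesis
    unfolding minv_def fdet_add_rank1[OF assms(1,2)] using assms
    by (simp add: qform_evec qform_evec_add field_simps)
qed

text \<open>Stands for \<open>S \<ge> t I\<close> with \<open>t > 0\<close>, encoded by the facts
  used later: a positive determinant and an inverse between 0 and \<open>1 / t\<close>. Both are
  carried along explicitly by rank-one updates.\<close>

definition pd_ge :: "nat \<Rightarrow> real \<Rightarrow> (nat \<Rightarrow> nat \<Rightarrow> real) \<Rightarrow> bool" where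
  "pd_ge m t S \<longleftrightarrow> 0 < t \<and> 0 < fdet m S \<and> inverse_pair m S (minv m S) \<and> psd_le m (1 / t) (minv m S)"

lemma pd_geI:
  assumes "0 < t" "0 < fdet m S" "inverse_pair m S R" "psd_le m (1 / t) R"
  shows "pd_ge m t S"
proof -
  have eq: "minv m S i k = R i k" if "i < m" "k < m" for i k
    using assms that by (intro minv_eqI) (auto simp: psd_le_def)
  have "qform m (minv m S) v = qform m R v" for v
    by (rule qform_cong) (auto simp: eq)
  then show ?thesis
    using assms unfolding pd_ge_def psd_le_def inverse_pair_def sym_on_def by (auto simp: eq cong: sum.cong_simp)
qed

lemma fdet_diag: "fdet m (\<lambda>i k. if i = k then t else 0) = t ^ m"
proof -
  have "mat m m (\<lambda>(i, k). if i = k then t else 0) = t \<cdot>\<^sub>m 1\<^sub>m m" by (rule eq_matI) auto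
  then show ?thesis unfolding fdet_def by simp
qed

lemma pd_ge_diag:
  assumes "0 < t"
  shows "pd_ge m t (\<lambda>i k. if i = k then t else 0)"
proof (rule pd_geI)
  show "inverse_pair m (\<lambda>i k. if i = k then t else 0) (\<lambda>i k. if i = k then 1 / t else 0)"
    using assms by (auto simp: inverse_pair_def mult_delta_left mult_delta_right sum.delta)
  have "qform m (\<lambda>i k. if i = k then 1 / t else 0) v = 1 / t * (\<Sum>i<m. (v i)\<^sup>2)" for v
    unfolding qform_def by (simp add: mult_delta_left sum.delta) (simp add: sum_distrib_left sum_divide_distrib power2_eq_square)
  then show "psd_le m (1 / t) (\<lambda>i k. if i = k then 1 / t else 0)"
    using assms by (auto simp: psd_le_def sym_on_def intro!: mult_nonneg_nonneg sum_nonneg divide_nonneg_pos)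
qed (use assms in \<open>auto simp: fdet_diag\<close>)

section \<open>Determinant, inverse and trace under rank-one updates\<close>

definition trace_on :: "nat \<Rightarrow> (nat \<Rightarrow> nat \<Rightarrow> real) \<Rightarrow> real" where
  "trace_on m R = (\<Sum>i<m. R i i)"

text \<open>The Sherman-Morrison formula, with \<open>R'\<close> as the candidate for the new
  inverse. Subtracting a rank-one term preserves the upper bound; nonnegativity is Cauchy-Schwarz
  for \<open>R\<close> between \<open>v\<close> and \<open>c\<close>, together with
  \<open>q \<le> 1 + q\<close>.\<close>

lemma pd_ge_add_rank1:
  fixes c :: "nat \<Rightarrow> real"
  assumes S: "pd_ge m t S"
  defines "R \<equiv> minv m S"
  defines "u \<equiv> \<lambda>i. \<Sum>k<m. R i k * c k"
  shows "pd_ge m t (rank1_update S c)"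
    and "fdet m (rank1_update S c) = fdet m S * (1 + qform m R c)"
    and "0 \<le> qform m R c"
    and "\<And>i k. i < m \<Longrightarrow> k < m \<Longrightarrow> minv m (rank1_update S c) i k = R i k - u i * u k / (1 + qform m R c)"
proof -
  define q where "q = qform m R c"
  define R' where "R' i k = R i k + (- 1 / (1 + q)) * rank1 u i k" for i k
  have t: "0 < t" and d: "0 < fdet m S" and inv: "inverse_pair m S R" and psd: "psd_le m (1 / t) R"
    using S unfolding pd_ge_def R_def by auto
  have sym: "sym_on m R" and nn: "\<And>v. 0 \<le> qform m R v" and le: "\<And>v. qform m R v \<le> 1 / t * (\<Sum>i<m. (v i)\<^sup>2)"
    using psd by (auto simp: psd_le_def)
  have q0: "0 \<le> q" unfolding q_def by (rule nn)
  show "0 \<le> qform m R c" by (rule nn)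
  show det: "fdet m (rank1_update S c) = fdet m S * (1 + qform m R c)"
    by (rule fdet_add_rank1[OF inv sym])
  have q_eq: "q = (\<Sum>i<m. c i * u i)" unfolding q_def u_def qform_eq_inner ..
  have cR: "(\<Sum>l<m. c l * R l k) = u k" if "k < m" for k
    unfolding u_def using sym that by (auto simp: sym_on_def intro!: sum.cong)
  have Su: "(\<Sum>l<m. S i l * u l) = c i" if "i < m" for i
    unfolding u_def by (rule inverse_pair_apply[OF inv that])
 have inv': "inverse_pair m (rank1_update S c) R'"
    unfolding inverse_pair_def
  proof (intro allI impI)
    fix i k assume ik: "i < m" "k < m"
    have "(\<Sum>l<m. (rank1_update S c) i l * R' l k)
      = (\<Sum>l<m. S i l * R l k) + c i * (\<Sum>l<m. c l * R l k)
        - (\<Sum>l<m. S i l * u l) * u k / (1 + q) - c i * (\<Sum>l<m. c l * u l) * u k / (1 + q)"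
      unfolding R'_def rank1_def rank1_update_def
      by (simp add: sum.distrib sum_distrib_left sum_distrib_right sum_subtractf sum_divide_distrib algebra_simps
          add_divide_distrib diff_divide_distrib)
    also have "\<dots> = (if i = k then 1 else 0) + c i * u k - c i * u k / (1 + q) - c i * q * u k / (1 + q)"
      using ik inv by (simp only: Su cR q_eq) (simp add: inverse_pair_def)
    also have "\<dots> = (if i = k then 1 else 0)"
    proof -
      have "1 + q \<noteq> 0" using q0 by simp
      then have "c i * u k - c i * u k / (1 + q) - c i * q * u k / (1 + q) = 0"
        by (simp add: divide_simps) (simp add: algebra_simps)
      then show ?thesis by simp
    qed
    finally show "(\<Sum>l<m. (rank1_update S c) i l * R' l k) = (if i = k then 1 else 0)" .
  qed
  have psd': "psd_le m (1 / t) R'"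
    unfolding psd_le_def
  proof (intro conjI allI)
    show "sym_on m R'" using sym by (auto simp: sym_on_def R'_def rank1_def)
    fix v
    have eq: "qform m R' v = qform m R v - (\<Sum>i<m. u i * v i)\<^sup>2 / (1 + q)"
      unfolding R'_def by (simp only: qform_add qform_scale qform_rank1) simp
    then show "qform m R' v \<le> 1 / t * (\<Sum>i<m. (v i)\<^sup>2)"
      using le[of v] q0 by (smt (verit) divide_nonneg_nonneg zero_le_power2)
    have "(\<Sum>i<m. u i * v i)\<^sup>2 \<le> qform m R v * q"
      using psd_cauchy_schwarz[OF psd, of v c] unfolding u_def q_def by (simp add: mult.commute)
    also have "\<dots> \<le> qform m R v * (1 + q)" using nn[of v] by (intro mult_left_mono) auto
    finally show "0 \<le> qform m R' v" using q0 unfolding eq by (simp add: field_simps)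
  qed
  have d': "0 < fdet m (rank1_update S c)" using d q0 unfolding det q_def by simp
  show "pd_ge m t (rank1_update S c)" by (rule pd_geI[OF t d' inv' psd'])
  show "minv m (rank1_update S c) i k = R i k - u i * u k / (1 + qform m R c)" if "i < m" "k < m" for i k
    using minv_eqI[OF inv' _ _ that] d' psd' unfolding psd_le_def by (simp add: R'_def rank1_def q_def)
qed

lemma trace_minv_add_rank1:
  assumes S: "pd_ge m t S"
  shows "i < m \<Longrightarrow> minv m (rank1_update S c) i i \<le> minv m S i i"
    and "trace_on m (minv m (rank1_update S c)) \<le> trace_on m (minv m S)"
proof -
  show *: "minv m (rank1_update S c) i i \<le> minv m S i i" if "i < m" for i
    using pd_ge_add_rank1(3,4)[OF S, where c=c] that by simp
  show "trace_on m (minv m (rank1_update S c)) \<le> trace_on m (minv m S)"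
    unfolding trace_on_def by (intro sum_mono *) simp
qed

text \<open>Expresses the form of a column in the inverse of the full matrix by the same form in the
  inverse without that column, of which the column is independent in the application.\<close>

lemma qform_minv_add_rank1:
  assumes S: "pd_ge m t S"
  shows "qform m (minv m (rank1_update S c)) c = 1 - 1 / (1 + qform m (minv m S) c)"
proof -
  define R where "R = minv m S"
  define u where "u = (\<lambda>i. \<Sum>k<m. R i k * c k)"
  define q where "q = qform m R c"
  note * = pd_ge_add_rank1[OF S, where c=c, folded R_def, folded u_def]
  have q0: "0 \<le> q" unfolding q_def by (rule *)
  have q_eq: "(\<Sum>i<m. u i * c i) = q" unfolding q_def u_def qform_eq_inner by (simp add: mult.commute)
  have "qform m (minv m (rank1_update S c)) c = qform m (\<lambda>i k. R i k + (- 1 / (1 + q)) * rank1 u i k) c"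
    by (rule qform_cong) (auto simp: *(4) rank1_def q_def u_def)
  also have "\<dots> = q - q\<^sup>2 / (1 + q)"
    by (simp only: qform_add qform_scale qform_rank1 q_eq) (simp add: q_def)
  also have "\<dots> = 1 - 1 / (1 + q)" using q0 by (simp add: field_simps power2_eq_square)
  finally show ?thesis by (simp add: q_def R_def)
qed

text \<open>A concavity estimate obtained without derivatives: \<open>h I\<close> is added one
  diagonal entry at a time, each step being a rank-one update. Step \<open>l\<close> raises the
  logarithm by \<open>ln (1 + h * minv m (Sl l) l l)\<close>, and the diagonal of the inverse only
  decreases on the way.\<close>

lemma ln_fdet_add_diag:
  assumes S: "pd_ge m t S" and h: "0 \<le> h"
  shows "ln (fdet m (\<lambda>i k. S i k + (if i = k then h else 0))) \<le> ln (fdet m S) + h * trace_on m (minv m S)"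
    and "fdet m S \<le> fdet m (\<lambda>i k. S i k + (if i = k then h else 0))"
proof -
  define Sl where "Sl l = (\<lambda>i k. S i k + (if i = k \<and> i < l then h else 0))" for l
  have "pd_ge m t (Sl l) \<and> (\<forall>i<m. minv m (Sl l) i i \<le> minv m S i i) \<and>
      ln (fdet m (Sl l)) \<le> ln (fdet m S) + h * (\<Sum>i<l. minv m S i i) \<and> fdet m S \<le> fdet m (Sl l)"
    if "l \<le> m" for l
    using that
  proof (induction l)
    case 0
    have "Sl 0 = S" by (auto simp: Sl_def)
    then show ?case using S by simp
  next
    case (Suc l)
    define c where "c = (\<lambda>i. sqrt h * evec l i)"
    have IH: "pd_ge m t (Sl l)" "\<And>i. i < m \<Longrightarrow> minv m (Sl l) i i \<le> minv m S i i"
      "ln (fdet m (Sl l)) \<le> ln (fdet m S) + h * (\<Sum>i<l. minv m S i i)" "fdet m S \<le> fdet m (Sl l)"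
      using Suc by auto
    have eq: "Sl (Suc l) = rank1_update (Sl l) c"
      using h by (auto simp: Sl_def c_def rank1_update_def evec_def fun_eq_iff less_Suc_eq)
    note up = pd_ge_add_rank1[OF IH(1), where c=c, folded eq]
    have qf: "qform m (minv m (Sl l)) c = h * minv m (Sl l) l l"
      unfolding c_def using Suc h by (simp add: qform_scale_vec qform_evec)
    have pos: "0 < fdet m (Sl l)" using IH(1) by (simp add: pd_ge_def)
    have "ln (fdet m (Sl (Suc l))) = ln (fdet m (Sl l)) + ln (1 + qform m (minv m (Sl l)) c)"
      unfolding up(2) using pos up(3) by (intro ln_mult_pos) auto
    also have "ln (1 + qform m (minv m (Sl l)) c) \<le> h * minv m (Sl l) l l"
      using ln_add_one_self_le_self[OF up(3)] unfolding qf .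
    also have "\<dots> \<le> h * minv m S l l" using IH(2) Suc h by (intro mult_left_mono) auto
    finally have 1: "ln (fdet m (Sl (Suc l))) \<le> ln (fdet m S) + h * (\<Sum>i<Suc l. minv m S i i)"
      using IH(3) by (simp add: distrib_left)
    have 2: "fdet m S \<le> fdet m (Sl (Suc l))"
      unfolding up(2) using IH(4) pos up(3) by (smt (verit) mult_le_cancel_left1)
    have "minv m (Sl (Suc l)) i i \<le> minv m S i i" if "i < m" for i
      using trace_minv_add_rank1(1)[OF IH(1) that, where c=c] IH(2)[OF that] unfolding eq by simp
    then show ?case using 1 2 up(1) by auto
  qed
  from this[of m] have "ln (fdet m (Sl m)) \<le> ln (fdet m S) + h * (\<Sum>i<m. minv m S i i)" "fdet m S \<le> fdet m (Sl m)" by auto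
  moreover have "fdet m (Sl m) = fdet m (\<lambda>i k. S i k + (if i = k then h else 0))"
    by (rule fdet_cong) (auto simp: Sl_def)
  ultimately show "ln (fdet m (\<lambda>i k. S i k + (if i = k then h else 0))) \<le> ln (fdet m S) + h * trace_on m (minv m S)"
     "fdet m S \<le> fdet m (\<lambda>i k. S i k + (if i = k then h else 0))"
    by (simp_all add: trace_on_def)
qed

section \<open>Gaussian quadratic forms\<close>

text \<open>\<open>gauss_space\<close> over an arbitrary index set, so that single columns can be
  split off and integrated separately.\<close>

definition gauss_pi :: "'i set \<Rightarrow> ('i \<Rightarrow> real) measure" where
  "gauss_pi I = (\<Pi>\<^sub>M p\<in>I. density lborel std_normal_density)"

definition std_moment :: "nat \<Rightarrow> real" where
  "std_moment k = (\<integral>x. x ^ k \<partial>density lborel std_normal_density)"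

lemma prob_space_std_normal: "prob_space (density lborel std_normal_density)"
  using prob_space_normal_density[of 1 0] by simp

interpretation std_normal: product_sigma_finite "\<lambda>_ :: 'i. density lborel std_normal_density"
  by (simp add: product_sigma_finite_def prob_space_imp_sigma_finite[OF prob_space_std_normal])

lemma prob_space_gauss_pi: "prob_space (gauss_pi I)"
  unfolding gauss_pi_def by (rule prob_space_PiM[OF prob_space_std_normal])

lemma integrable_std_normal_power: "integrable (density lborel std_normal_density) (\<lambda>x. x ^ k)"
  by (subst integrable_density) (auto simp: integrable_std_normal_moment intro!: AE_I2 normal_density_nonneg)

lemma std_moment_eq: "std_moment k = (\<integral>x. std_normal_density x * x ^ k \<partial>lborel)"
  unfolding std_moment_def by (subst integral_density) (auto intro!: AE_I2 normal_density_nonneg)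

lemma std_moment_even: "std_moment (2 * k) = fact (2 * k) / (2 ^ k * fact k)"
  unfolding std_moment_eq by (rule integral_std_normal_moment_even)

lemma std_moment_odd: "odd k \<Longrightarrow> std_moment k = 0"
  unfolding std_moment_eq using integral_std_normal_moment_odd by (auto elim!: oddE)

lemma std_moment_simps [simp]: "std_moment 0 = 1" "std_moment (Suc 0) = 0" "std_moment 2 = 1"
    "std_moment 4 = 3" "std_moment (Suc (Suc 0)) = 1" "std_moment (Suc (Suc (Suc (Suc 0)))) = 3"
  using std_moment_even[of 0] std_moment_odd[of 1] std_moment_even[of 1] std_moment_even[of 2]
  by (simp_all add: fact_numeral numeral_eq_Suc)

lemma measurable_gauss_component:
  "p \<in> I \<Longrightarrow> (\<lambda>x. x p) \<in> borel_measurable (gauss_pi I)"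
  using measurable_component_singleton[of p I "\<lambda>_. density lborel std_normal_density"]
  unfolding gauss_pi_def by (simp cong: measurable_cong_sets)

lemma gauss_pi_monomial:
  assumes "finite I"
  shows "integrable (gauss_pi I) (\<lambda>x. \<Prod>p\<in>I. x p ^ k p)"
    and "(\<integral>x. (\<Prod>p\<in>I. x p ^ k p) \<partial>gauss_pi I) = (\<Prod>p\<in>I. std_moment (k p))"
  unfolding gauss_pi_def std_moment_def
  by (rule std_normal.product_integrable_prod std_normal.product_integral_prod; simp add: assms integrable_std_normal_power)+

lemma prod_delta_power:
  fixes x :: "'i \<Rightarrow> real"
  assumes "finite I" "p \<in> I"
  shows "(\<Prod>z\<in>I. x z ^ of_bool (z = p)) = x p"
proof -
  have "(\<Prod>z\<in>I. x z ^ of_bool (z = p)) = (\<Prod>z\<in>I. if z = p then x z else 1)"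
    by (intro prod.cong) auto
  then show ?thesis using assms by (simp add: prod.delta)
qed

lemma gauss_pi_moment2:
  assumes I: "finite I" "p \<in> I" "q \<in> I"
  shows "integrable (gauss_pi I) (\<lambda>x. x p * x q)"
    and "(\<integral>x. x p * x q \<partial>gauss_pi I) = of_bool (p = q)"
proof -
  define k where "k z = of_bool (z = p) + (of_bool (z = q) :: nat)" for z
  have eq: "(\<lambda>x. x p * x q) = (\<lambda>x. \<Prod>z\<in>I. (x z :: real) ^ k z)"
    using I by (simp add: k_def power_add prod.distrib prod_delta_power fun_eq_iff)
  show "integrable (gauss_pi I) (\<lambda>x. x p * x q)"
    unfolding eq by (rule gauss_pi_monomial[OF I(1)])
  show "(\<integral>x. x p * x q \<partial>gauss_pi I) = of_bool (p = q)"
  proof (cases "p = q")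
    case True
    then show ?thesis unfolding eq gauss_pi_monomial(2)[OF I(1)] by (auto simp: k_def intro!: prod.neutral)
  next
    case False
    then show ?thesis unfolding eq gauss_pi_monomial(2)[OF I(1)] using I
      by (auto simp: k_def intro!: prod_zero bexI[of _ p])
  qed
qed

text \<open>Isserlis' formula for four factors, by counting the multiplicity \<open>k z\<close> of
  each variable. An odd multiplicity makes both sides zero; four equal indices give the fourth
  moment 3, the number of pairings.\<close>

lemma gauss_pi_moment4:
  assumes I: "finite I" "p \<in> I" "q \<in> I" "r \<in> I" "s \<in> I"
  shows "integrable (gauss_pi I) (\<lambda>x. x p * x q * (x r * x s))"
    and "(\<integral>x. x p * x q * (x r * x s) \<partial>gauss_pi I)
      = of_bool (p = q) * of_bool (r = s) + of_bool (p = r) * of_bool (q = s) + of_bool (p = s) * of_bool (q = r)"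
proof -
  define k where "k z = of_bool (z = p) + of_bool (z = q) + (of_bool (z = r) + (of_bool (z = s) :: nat))" for z
  have eq: "(\<lambda>x. x p * x q * (x r * x s)) = (\<lambda>x. \<Prod>z\<in>I. (x z :: real) ^ k z)"
    using I by (simp add: k_def power_add prod.distrib prod_delta_power fun_eq_iff)
  show "integrable (gauss_pi I) (\<lambda>x. x p * x q * (x r * x s))"
    unfolding eq by (rule gauss_pi_monomial[OF I(1)])
  have zero: "(\<Prod>z\<in>I. std_moment (k z)) = 0" if "z \<in> I" "odd (k z)" for z
    using that I(1) std_moment_odd by (auto intro!: prod_zero)
  show "(\<integral>x. x p * x q * (x r * x s) \<partial>gauss_pi I)
      = of_bool (p = q) * of_bool (r = s) + of_bool (p = r) * of_bool (q = s) + of_bool (p = s) * of_bool (q = r)"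
    unfolding eq gauss_pi_monomial(2)[OF I(1)]
  proof -
    consider (four) "q = p" "r = p" "s = p"
      | (odd) z where "z \<in> {p, q, r, s}" "odd (k z)"
      | (pairs) "p = q" "r = s" "p \<noteq> r" | (pairs') "p = r" "q = s" "p \<noteq> q" | (pairs'') "p = s" "q = r" "p \<noteq> q"
    proof -
      have "odd (k p) \<or> odd (k q) \<or> odd (k r) \<or> odd (k s) \<or> (q = p \<and> r = p \<and> s = p) \<or>
         (p = q \<and> r = s \<and> p \<noteq> r) \<or> (p = r \<and> q = s \<and> p \<noteq> q) \<or> (p = s \<and> q = r \<and> p \<noteq> q)"
        unfolding k_def by (auto simp: of_bool_def)
      then show ?thesis using that by blast
    qed
    then show "(\<Prod>z\<in>I. std_moment (k z)) = of_bool (p = q) * of_bool (r = s)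
        + of_bool (p = r) * of_bool (q = s) + of_bool (p = s) * of_bool (q = r)"
    proof cases
      case four
      then have "(\<Prod>z\<in>I. std_moment (k z)) = (\<Prod>z\<in>I. if z = p then 3 else 1)"
        by (intro prod.cong) (auto simp: k_def)
      then show ?thesis using four I by (simp add: prod.delta)
    next
      case odd
      then have "(\<Prod>z\<in>I. std_moment (k z)) = 0" using zero I by blast
      moreover have "\<not> (p = q \<and> r = s)" "\<not> (p = r \<and> q = s)" "\<not> (p = s \<and> q = r)"
        using odd unfolding k_def by (auto simp: of_bool_def split: if_splits)
      ultimately show ?thesis by (auto simp: of_bool_def)
    qed (auto simp: k_def intro!: prod.neutral)
  qed
qed

lemma integral_double_sum:
  fixes f :: "'a \<Rightarrow> 'b \<Rightarrow> 'c \<Rightarrow> real"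
  assumes "\<And>i k. i \<in> A \<Longrightarrow> k \<in> B \<Longrightarrow> integrable M (f i k)"
  shows "(\<integral>x. (\<Sum>i\<in>A. \<Sum>k\<in>B. f i k x) \<partial>M) = (\<Sum>i\<in>A. \<Sum>k\<in>B. \<integral>x. f i k x \<partial>M)"
proof -
  have "(\<integral>x. (\<Sum>i\<in>A. \<Sum>k\<in>B. f i k x) \<partial>M) = (\<Sum>i\<in>A. \<integral>x. (\<Sum>k\<in>B. f i k x) \<partial>M)"
    using assms by (intro Bochner_Integration.integral_sum Bochner_Integration.integrable_sum)
  also have "\<dots> = (\<Sum>i\<in>A. \<Sum>k\<in>B. \<integral>x. f i k x \<partial>M)"
    using assms by (intro sum.cong refl Bochner_Integration.integral_sum)
  finally show ?thesis .
qed

text \<open>Of the three pairings in the fourth moment, one gives the squared trace and the other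
  two, by symmetry of \<open>Q\<close>, the squared Frobenius norm each. The injection
  \<open>e\<close> will send a row index to its cell in a fixed column.\<close>

lemma gauss_quadratic_moments:
  assumes I: "finite I" "inj_on e {..<m}" "e ` {..<m} \<subseteq> I" and sym: "sym_on m Q"
  defines "q \<equiv> \<lambda>x. qform m Q (\<lambda>i. x (e i))"
  shows "integrable (gauss_pi I) q" "(\<integral>x. q x \<partial>gauss_pi I) = trace_on m Q"
    "integrable (gauss_pi I) (\<lambda>x. (q x)\<^sup>2)"
    "(\<integral>x. (q x)\<^sup>2 \<partial>gauss_pi I) = (trace_on m Q)\<^sup>2 + 2 * (\<Sum>i<m. \<Sum>k<m. (Q i k)\<^sup>2)"
proof -
  have eI: "e i \<in> I" if "i < m" for i using I that by auto
  have e_eq: "e i = e k \<longleftrightarrow> i = k" if "i < m" "k < m" for i k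
    using I that by (auto simp: inj_on_eq_iff)
  have q: "q = (\<lambda>x. \<Sum>i<m. \<Sum>k<m. Q i k * (x (e i) * x (e k)))"
    by (simp add: q_def qform_def mult.assoc)
  have q2: "(\<lambda>x. (q x)\<^sup>2) = (\<lambda>x. \<Sum>i<m. \<Sum>k<m. \<Sum>j<m. \<Sum>l<m.
      Q i k * Q j l * (x (e i) * x (e k) * (x (e j) * x (e l))))"
    unfolding q power2_eq_square sum_product
    by (rule ext, rule sum.cong, rule refl, subst sum.swap) (simp add: mult_ac)
  show "integrable (gauss_pi I) q" unfolding q
    using eI I by (intro Bochner_Integration.integrable_sum integrable_mult_right gauss_pi_moment2) auto
  have sd: "(\<Sum>l<m. f l * of_bool (j = l)) = f j" if "j < m" for f :: "nat \<Rightarrow> real" and j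
    using that by (simp add: of_bool_def mult_delta_right sum.delta cong: if_cong)
  have tr: "(\<Sum>i<m. \<Sum>k<m. Q i k * of_bool (i = k)) = trace_on m Q"
    unfolding trace_on_def by (intro sum.cong refl sd) simp
  have "(\<integral>x. q x \<partial>gauss_pi I) = (\<Sum>i<m. \<Sum>k<m. \<integral>x. Q i k * (x (e i) * x (e k)) \<partial>gauss_pi I)"
    unfolding q using eI I
    by (intro integral_double_sum integrable_mult_right gauss_pi_moment2(1)) auto
  also have "\<dots> = (\<Sum>i<m. \<Sum>k<m. Q i k * of_bool (i = k))"
    using eI I by (intro sum.cong refl) (simp add: gauss_pi_moment2 e_eq)
  finally show "(\<integral>x. q x \<partial>gauss_pi I) = trace_on m Q" unfolding tr .
  show "integrable (gauss_pi I) (\<lambda>x. (q x)\<^sup>2)" unfolding q2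
    using eI I by (intro Bochner_Integration.integrable_sum integrable_mult_right gauss_pi_moment4) auto
  have "(\<integral>x. (q x)\<^sup>2 \<partial>gauss_pi I) = (\<Sum>i<m. \<Sum>k<m. \<Sum>j<m. \<Sum>l<m.
      (\<integral>x. Q i k * Q j l * (x (e i) * x (e k) * (x (e j) * x (e l))) \<partial>gauss_pi I))"
    unfolding q2 using eI I
    by (subst integral_double_sum)
       (intro Bochner_Integration.integrable_sum integrable_mult_right gauss_pi_moment4(1) sum.cong refl
         integral_double_sum; auto)+
  also have "\<dots> = (\<Sum>i<m. \<Sum>k<m. \<Sum>j<m. \<Sum>l<m. Q i k * Q j l *
      (of_bool (i = k) * of_bool (j = l) + of_bool (i = j) * of_bool (k = l) + of_bool (k = j) * of_bool (i = l)))"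
    using eI I by (intro sum.cong refl) (simp add: gauss_pi_moment4 e_eq mult.commute)
  also have "\<dots> = (\<Sum>i<m. \<Sum>k<m. \<Sum>j<m. \<Sum>l<m. Q i k * Q j l * (of_bool (i = k) * of_bool (j = l)))
      + (\<Sum>i<m. \<Sum>k<m. \<Sum>j<m. \<Sum>l<m. Q i k * Q j l * (of_bool (i = j) * of_bool (k = l)))
      + (\<Sum>i<m. \<Sum>k<m. \<Sum>j<m. \<Sum>l<m. Q i k * Q j l * (of_bool (k = j) * of_bool (i = l)))"
    by (simp only: distrib_left sum.distrib)
  also have "(\<Sum>i<m. \<Sum>k<m. \<Sum>j<m. \<Sum>l<m. Q i k * Q j l * (of_bool (i = k) * of_bool (j = l))) = (trace_on m Q)\<^sup>2"
    unfolding tr[symmetric] power2_eq_square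
    unfolding sum_distrib_left sum_distrib_right by (intro sum.cong refl) (simp only: mult_ac)
  also have "(\<Sum>i<m. \<Sum>k<m. \<Sum>j<m. \<Sum>l<m. Q i k * Q j l * (of_bool (i = j) * of_bool (k = l))) = (\<Sum>i<m. \<Sum>k<m. (Q i k)\<^sup>2)"
  proof (intro sum.cong refl)
    fix i k assume "i \<in> {..<m}" "k \<in> {..<m}"
    then have ik: "i < m" "k < m" by auto
    have "(\<Sum>j<m. \<Sum>l<m. Q i k * Q j l * (of_bool (i = j) * of_bool (k = l)))
      = (\<Sum>j<m. \<Sum>l<m. Q i k * Q j l * of_bool (i = j) * of_bool (k = l))"
      by (simp only: mult.assoc)
    also have "\<dots> = (\<Sum>j<m. Q i k * Q j k * of_bool (i = j))"
      using ik by (intro sum.cong refl sd)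
    also have "\<dots> = (Q i k)\<^sup>2"
      using ik by (subst sd) (simp_all add: power2_eq_square)
    finally show "(\<Sum>j<m. \<Sum>l<m. Q i k * Q j l * (of_bool (i = j) * of_bool (k = l))) = (Q i k)\<^sup>2" .
  qed
  also have "(\<Sum>i<m. \<Sum>k<m. \<Sum>j<m. \<Sum>l<m. Q i k * Q j l * (of_bool (k = j) * of_bool (i = l))) = (\<Sum>i<m. \<Sum>k<m. Q i k * Q k i)"
  proof (intro sum.cong refl)
    fix i k assume "i \<in> {..<m}" "k \<in> {..<m}"
    then have ik: "i < m" "k < m" by auto
    have "(\<Sum>j<m. \<Sum>l<m. Q i k * Q j l * (of_bool (k = j) * of_bool (i = l)))
      = (\<Sum>j<m. \<Sum>l<m. Q i k * Q j l * of_bool (k = j) * of_bool (i = l))"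
      by (simp only: mult.assoc)
    also have "\<dots> = (\<Sum>j<m. Q i k * Q j i * of_bool (k = j))"
      using ik by (intro sum.cong refl sd)
    also have "\<dots> = Q i k * Q k i"
      using ik by (subst sd) (simp_all add: power2_eq_square)
    finally show "(\<Sum>j<m. \<Sum>l<m. Q i k * Q j l * (of_bool (k = j) * of_bool (i = l))) = Q i k * Q k i" .
  qed
  also have "\<dots> = (\<Sum>i<m. \<Sum>k<m. (Q i k)\<^sup>2)"
    using sym by (intro sum.cong) (auto simp: sym_on_def power2_eq_square)
  finally show "(\<integral>x. (q x)\<^sup>2 \<partial>gauss_pi I) = (trace_on m Q)\<^sup>2 + 2 * (\<Sum>i<m. \<Sum>k<m. (Q i k)\<^sup>2)" by simp
qed

text \<open>Expand \<open>1 / (1 + q)\<close> around the mean: the linear term has expectation 0,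
  and \<open>q \<ge> 0\<close> bounds the exact quadratic remainder by the squared deviation over
  the square of \<open>1 + \<mu>\<close>. A variance of at most \<open>2 * r * \<mu>\<close> makes
  this a relative error of \<open>2 * r\<close>. The logarithmic bound then follows from
  \<open>ln z \<le> z - 1\<close> at \<open>z = (1 + \<mu>) / (1 + q)\<close>.\<close>

lemma (in prob_space) inverse_moment_bound:
  fixes q :: "'a \<Rightarrow> real"
  assumes q0: "\<And>x. 0 \<le> q x" and q1: "integrable M q" and q2: "integrable M (\<lambda>x. (q x)\<^sup>2)"
    and \<mu>: "expectation q = \<mu>" and v: "expectation (\<lambda>x. (q x)\<^sup>2) \<le> \<mu>\<^sup>2 + 2 * r * \<mu>" and r: "0 \<le> r"
  shows "integrable M (\<lambda>x. 1 / (1 + q x))"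
    and "expectation (\<lambda>x. 1 / (1 + q x)) \<le> (1 + 2 * r) / (1 + \<mu>)"
    and "integrable M (\<lambda>x. ln (1 + q x))"
    and "ln (1 + \<mu>) \<le> expectation (\<lambda>x. ln (1 + q x)) + 2 * r"
proof -
  have [measurable]: "q \<in> borel_measurable M" using q1 by simp
  have \<mu>0: "0 \<le> \<mu>" unfolding \<mu>[symmetric] by (rule Bochner_Integration.integral_nonneg) (rule q0)
  have bnd: "1 / (1 + q x) \<le> 1" for x using q0[of x] by simp
  show int: "integrable M (\<lambda>x. 1 / (1 + q x))"
  proof (rule integrable_const_bound[where B=1])
    show "AE x in M. norm (1 / (1 + q x)) \<le> 1"
      by (rule AE_I2) (use q0 bnd in simp)
    show "(\<lambda>x. 1 / (1 + q x)) \<in> borel_measurable M" by measurable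
  qed
  have int2: "integrable M (\<lambda>x. (\<mu> - q x)\<^sup>2)"
    unfolding power2_diff using q1 q2 by simp
  have "expectation (\<lambda>x. (\<mu> - q x)\<^sup>2) = \<mu>\<^sup>2 + expectation (\<lambda>x. (q x)\<^sup>2) - 2 * \<mu> * expectation q"
    unfolding power2_diff using q1 q2 by (simp add: prob_space)
  then have var: "expectation (\<lambda>x. (\<mu> - q x)\<^sup>2) \<le> 2 * r * \<mu>"
    using v \<mu> by (simp add: power2_eq_square)
  have "expectation (\<lambda>x. 1 / (1 + q x)) \<le> expectation (\<lambda>x. 1 / (1 + \<mu>) + (\<mu> - q x) / (1 + \<mu>)\<^sup>2 + (\<mu> - q x)\<^sup>2 / (1 + \<mu>)\<^sup>2)"
  proof (rule integral_mono[OF int])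
    show "integrable M (\<lambda>x. 1 / (1 + \<mu>) + (\<mu> - q x) / (1 + \<mu>)\<^sup>2 + (\<mu> - q x)\<^sup>2 / (1 + \<mu>)\<^sup>2)"
      using q1 int2 by simp
    fix x
    have nz: "1 + q x \<noteq> 0" "1 + \<mu> \<noteq> 0" using q0[of x] \<mu>0 by auto
    have "1 / (1 + q x) = 1 / (1 + \<mu>) + (\<mu> - q x) / (1 + \<mu>)\<^sup>2 + (\<mu> - q x)\<^sup>2 / ((1 + \<mu>)\<^sup>2 * (1 + q x))"
      using nz by (simp add: divide_simps) (simp add: power2_eq_square algebra_simps)
    also have "(\<mu> - q x)\<^sup>2 / ((1 + \<mu>)\<^sup>2 * (1 + q x)) \<le> (\<mu> - q x)\<^sup>2 / (1 + \<mu>)\<^sup>2"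
      using q0[of x] \<mu>0 by (intro divide_left_mono) (auto simp: zero_less_mult_iff)
    finally show "1 / (1 + q x) \<le> 1 / (1 + \<mu>) + (\<mu> - q x) / (1 + \<mu>)\<^sup>2 + (\<mu> - q x)\<^sup>2 / (1 + \<mu>)\<^sup>2"
      by simp
  qed
  also have "\<dots> = 1 / (1 + \<mu>) + expectation (\<lambda>x. (\<mu> - q x)\<^sup>2) / (1 + \<mu>)\<^sup>2"
    using q1 \<mu> int2 by (simp add: prob_space)
  also have "\<dots> \<le> 1 / (1 + \<mu>) + 2 * r * (1 + \<mu>) / (1 + \<mu>)\<^sup>2"
  proof -
    have "2 * r * \<mu> \<le> 2 * r * (1 + \<mu>)" using r by (intro mult_left_mono) auto
    then show ?thesis using var by (intro add_left_mono divide_right_mono) auto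
  qed
  also have "\<dots> = (1 + 2 * r) / (1 + \<mu>)"
  proof -
    have "1 + \<mu> \<noteq> 0" using \<mu>0 by simp
    then show ?thesis by (simp add: power2_eq_square add_divide_distrib)
  qed
  finally show inv: "expectation (\<lambda>x. 1 / (1 + q x)) \<le> (1 + 2 * r) / (1 + \<mu>)" .
  show int_ln: "integrable M (\<lambda>x. ln (1 + q x))"
  proof (rule Bochner_Integration.integrable_bound[OF q1])
    show "AE x in M. norm (ln (1 + q x)) \<le> norm (q x)"
      by (rule AE_I2) (use q0 ln_add_one_self_le_self in simp)
    show "(\<lambda>x. ln (1 + q x)) \<in> borel_measurable M" by measurable
  qed
  have "(1 + \<mu>) * expectation (\<lambda>x. 1 / (1 + q x)) \<le> 1 + 2 * r"
    using inv \<mu>0 by (simp add: pos_le_divide_eq mult.commute)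
  then have "ln (1 + \<mu>) + 1 - (1 + 2 * r) \<le> ln (1 + \<mu>) + 1 - (1 + \<mu>) * expectation (\<lambda>x. 1 / (1 + q x))"
    by simp
  also have "\<dots> = expectation (\<lambda>x. ln (1 + \<mu>) + 1 - (1 + \<mu>) * (1 / (1 + q x)))"
    using int by (simp add: prob_space del: times_divide_eq_right)
  also have "\<dots> \<le> expectation (\<lambda>x. ln (1 + q x))"
  proof (rule integral_mono[OF _ int_ln])
    show "integrable M (\<lambda>x. ln (1 + \<mu>) + 1 - (1 + \<mu>) * (1 / (1 + q x)))"
      by (intro Bochner_Integration.integrable_diff integrable_mult_right int) simp
    fix x
    have "ln ((1 + \<mu>) / (1 + q x)) \<le> (1 + \<mu>) / (1 + q x) - 1"
      using q0[of x] \<mu>0 by (intro ln_le_minus_one) auto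
    then show "ln (1 + \<mu>) + 1 - (1 + \<mu>) * (1 / (1 + q x)) \<le> ln (1 + q x)"
      using q0[of x] \<mu>0 by (simp add: ln_div)
  qed
  finally show "ln (1 + \<mu>) \<le> expectation (\<lambda>x. ln (1 + q x)) + 2 * r"
    by simp
qed

lemma gauss_psd_quadratic:
  assumes I: "finite I" "inj_on e {..<m}" "e ` {..<m} \<subseteq> I" and psd: "psd_le m r Q" and r: "0 \<le> r"
  shows "integrable (gauss_pi I) (\<lambda>x. 1 / (1 + qform m Q (\<lambda>i. x (e i))))"
    and "(\<integral>x. 1 / (1 + qform m Q (\<lambda>i. x (e i))) \<partial>gauss_pi I) \<le> (1 + 2 * r) / (1 + trace_on m Q)"
    and "integrable (gauss_pi I) (\<lambda>x. ln (1 + qform m Q (\<lambda>i. x (e i))))"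
    and "ln (1 + trace_on m Q) \<le> (\<integral>x. ln (1 + qform m Q (\<lambda>i. x (e i))) \<partial>gauss_pi I) + 2 * r"
    and "integrable (gauss_pi I) (\<lambda>x. qform m Q (\<lambda>i. x (e i)))"
    and "(\<integral>x. qform m Q (\<lambda>i. x (e i)) \<partial>gauss_pi I) = trace_on m Q"
proof -
  interpret prob_space "gauss_pi I" by (rule prob_space_gauss_pi)
  have sym: "sym_on m Q" and nn: "\<And>v. 0 \<le> qform m Q v" using psd by (auto simp: psd_le_def)
  note mom = gauss_quadratic_moments[OF I sym]
  have "(\<integral>x. (qform m Q (\<lambda>i. x (e i)))\<^sup>2 \<partial>gauss_pi I) \<le> (trace_on m Q)\<^sup>2 + 2 * r * trace_on m Q"
    unfolding mom(4) using psd_frobenius[OF psd] by (simp add: trace_on_def)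
  note b = inverse_moment_bound[OF nn mom(1) mom(3) mom(2) this r]
  show "integrable (gauss_pi I) (\<lambda>x. 1 / (1 + qform m Q (\<lambda>i. x (e i))))" by (rule b(1))
  show "(\<integral>x. 1 / (1 + qform m Q (\<lambda>i. x (e i))) \<partial>gauss_pi I) \<le> (1 + 2 * r) / (1 + trace_on m Q)" by (rule b(2))
  show "integrable (gauss_pi I) (\<lambda>x. ln (1 + qform m Q (\<lambda>i. x (e i))))" by (rule b(3))
  show "ln (1 + trace_on m Q) \<le> (\<integral>x. ln (1 + qform m Q (\<lambda>i. x (e i))) \<partial>gauss_pi I) + 2 * r" by (rule b(4))
  show "integrable (gauss_pi I) (\<lambda>x. qform m Q (\<lambda>i. x (e i)))" by (rule mom(1))
  show "(\<integral>x. qform m Q (\<lambda>i. x (e i)) \<partial>gauss_pi I) = trace_on m Q" by (rule mom(2))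
qed

section \<open>Random Gram matrices\<close>

text \<open>Plain integrability is not closed under products, finiteness of all absolute moments is;
  by the Leibniz formula it therefore passes from the entries to the determinant.\<close>

definition has_moments :: "'a measure \<Rightarrow> ('a \<Rightarrow> real) \<Rightarrow> bool" where
  "has_moments M f \<longleftrightarrow> f \<in> borel_measurable M \<and> (\<forall>k. integrable M (\<lambda>x. \<bar>f x\<bar> ^ k))"

lemma has_moments_measurable: "has_moments M f \<Longrightarrow> f \<in> borel_measurable M"
  by (simp add: has_moments_def)

lemma has_moments_integrable:
  assumes "has_moments M f"
  shows "integrable M f"
proof -
  have "integrable M (\<lambda>x. \<bar>f x\<bar> ^ 1)" and m: "f \<in> borel_measurable M"
    using assms unfolding has_moments_def by blast+
  then have "integrable M (\<lambda>x. \<bar>f x\<bar>)" by simp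
  then show ?thesis by (rule integrable_abs_cancel[OF _ m])
qed

lemma (in prob_space) has_moments_const: "has_moments M (\<lambda>_. c)"
  by (simp add: has_moments_def)

lemma has_moments_mult:
  assumes "has_moments M f" "has_moments M g"
  shows "has_moments M (\<lambda>x. f x * g x)"
  unfolding has_moments_def
proof (intro conjI allI)
  have [measurable]: "f \<in> borel_measurable M" "g \<in> borel_measurable M"
    using assms by (auto simp: has_moments_def)
  show "(\<lambda>x. f x * g x) \<in> borel_measurable M" by measurable
  fix k
  have "integrable M (\<lambda>x. \<bar>f x\<bar> ^ (2 * k) + \<bar>g x\<bar> ^ (2 * k))"
    using assms by (intro Bochner_Integration.integrable_add) (auto simp: has_moments_def)
  then show "integrable M (\<lambda>x. \<bar>f x * g x\<bar> ^ k)"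
  proof (rule Bochner_Integration.integrable_bound)
    show "AE x in M. norm (\<bar>f x * g x\<bar> ^ k) \<le> norm (\<bar>f x\<bar> ^ (2 * k) + \<bar>g x\<bar> ^ (2 * k))"
    proof (rule AE_I2)
      fix x
      define u v where "u = \<bar>f x\<bar> ^ k" and "v = \<bar>g x\<bar> ^ k"
      have "0 \<le> u" "0 \<le> v" by (simp_all add: u_def v_def)
      then have "u * v \<le> u\<^sup>2 + v\<^sup>2"
        using sum_squares_bound[of u v] mult_nonneg_nonneg[of u v] by linarith
      then show "norm (\<bar>f x * g x\<bar> ^ k) \<le> norm (\<bar>f x\<bar> ^ (2 * k) + \<bar>g x\<bar> ^ (2 * k))"
        by (simp add: u_def v_def abs_mult power_mult_distrib power_mult mult.commute[of 2])
    qed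
  qed measurable
qed

lemma has_moments_add:
  assumes "has_moments M f" "has_moments M g"
  shows "has_moments M (\<lambda>x. f x + g x)"
  unfolding has_moments_def
proof (intro conjI allI)
  have [measurable]: "f \<in> borel_measurable M" "g \<in> borel_measurable M"
    using assms by (auto simp: has_moments_def)
  show "(\<lambda>x. f x + g x) \<in> borel_measurable M" by measurable
  fix k
  have "integrable M (\<lambda>x. 2 ^ k * (\<bar>f x\<bar> ^ k + \<bar>g x\<bar> ^ k))"
    using assms by (intro integrable_mult_right Bochner_Integration.integrable_add) (auto simp: has_moments_def)
  then show "integrable M (\<lambda>x. \<bar>f x + g x\<bar> ^ k)"
  proof (rule Bochner_Integration.integrable_bound)
    show "AE x in M. norm (\<bar>f x + g x\<bar> ^ k) \<le> norm (2 ^ k * (\<bar>f x\<bar> ^ k + \<bar>g x\<bar> ^ k))"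
    proof (rule AE_I2)
      fix x
      have "\<bar>f x + g x\<bar> ^ k \<le> (2 * max \<bar>f x\<bar> \<bar>g x\<bar>) ^ k"
        by (rule power_mono) auto
      also have "\<dots> \<le> 2 ^ k * (\<bar>f x\<bar> ^ k + \<bar>g x\<bar> ^ k)"
        by (auto simp: power_mult_distrib max_def)
      finally show "norm (\<bar>f x + g x\<bar> ^ k) \<le> norm (2 ^ k * (\<bar>f x\<bar> ^ k + \<bar>g x\<bar> ^ k))" by simp
    qed
  qed measurable
qed

lemma (in prob_space) has_moments_sum:
  "(\<And>i. i \<in> A \<Longrightarrow> has_moments M (f i)) \<Longrightarrow> has_moments M (\<lambda>x. \<Sum>i\<in>A. f i x)"
  by (induction A rule: infinite_finite_induct) (auto intro: has_moments_add has_moments_const)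

lemma (in prob_space) has_moments_prod:
  "(\<And>i. i \<in> A \<Longrightarrow> has_moments M (f i)) \<Longrightarrow> has_moments M (\<lambda>x. \<Prod>i\<in>A. f i x)"
  by (induction A rule: infinite_finite_induct) (auto intro: has_moments_mult has_moments_const)

section \<open>Moments and measurability of determinants and inverses\<close>

lemma permutes_less:
  fixes p :: "nat \<Rightarrow> nat"
  shows "p permutes {0..<m} \<Longrightarrow> i < m \<Longrightarrow> p i < m"
  using permutes_in_image[of p "{0..<m}" i] by simp

lemma fdet_leibniz:
  "fdet m S = (\<Sum>p\<in>{p. p permutes {0..<m}}. signof p * (\<Prod>i=0..<m. S i (p i)))"
  unfolding fdet_def
  by (subst det_def'[of _ m]) (auto intro!: sum.cong prod.cong simp: permutes_less)

lemma (in prob_space) has_moments_fdet: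
  assumes "\<And>i k. i < m \<Longrightarrow> k < m \<Longrightarrow> has_moments M (\<lambda>x. S x i k)"
  shows "has_moments M (\<lambda>x. fdet m (S x))"
  unfolding fdet_leibniz
  by (intro has_moments_sum has_moments_mult has_moments_prod has_moments_const assms) (auto intro: permutes_less)

lemma measurable_fdet:
  assumes "\<And>i k. i < m \<Longrightarrow> k < m \<Longrightarrow> (\<lambda>x. S x i k) \<in> borel_measurable M"
  shows "(\<lambda>x. fdet m (S x)) \<in> borel_measurable M"
  unfolding fdet_leibniz
  by (intro borel_measurable_sum borel_measurable_times borel_measurable_prod borel_measurable_const assms)
     (auto intro: permutes_less)

lemma measurable_minv:
  assumes "\<And>i k. i < m \<Longrightarrow> k < m \<Longrightarrow> (\<lambda>x. S x i k) \<in> borel_measurable M"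
  shows "(\<lambda>x. minv m (S x) i k) \<in> borel_measurable M"
  unfolding minv_def rank1_update_def
  by (intro borel_measurable_divide borel_measurable_add borel_measurable_diff borel_measurable_times
      measurable_fdet borel_measurable_const assms)

lemma gauss_pi_has_moments:
  assumes "p \<in> I"
  shows "has_moments (gauss_pi I) (\<lambda>x. x p)"
  unfolding has_moments_def
proof (intro conjI allI measurable_gauss_component[OF assms])
  fix k :: nat
  have "integrable (density lborel std_normal_density) (\<lambda>x. \<bar>x\<bar> ^ k)"
    using integrable_norm[OF integrable_std_normal_power[of k]] by (simp add: power_abs)
  then have "integrable (distr (gauss_pi I) (density lborel std_normal_density) (\<lambda>x. x p)) (\<lambda>x. \<bar>x\<bar> ^ k)"
    unfolding gauss_pi_def using distr_PiM_component[OF prob_space_std_normal assms] by simp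
  then show "integrable (gauss_pi I) (\<lambda>x. \<bar>x p\<bar> ^ k)"
    unfolding gauss_pi_def
    by (rule integrable_distr[OF measurable_component_singleton[OF assms]])
qed

lemma gauss_pi_fold:
  fixes F :: "('i \<Rightarrow> real) \<Rightarrow> real"
  assumes "I \<inter> J = {}" "finite I" "finite J" and F: "integrable (gauss_pi (I \<union> J)) F"
  shows "integrable (gauss_pi I) (\<lambda>y. \<integral>x. F (merge I J (y, x)) \<partial>gauss_pi J)"
    and "(\<integral>x. F x \<partial>gauss_pi (I \<union> J)) = (\<integral>y. (\<integral>x. F (merge I J (y, x)) \<partial>gauss_pi J) \<partial>gauss_pi I)"
proof -
  show "(\<integral>x. F x \<partial>gauss_pi (I \<union> J)) = (\<integral>y. (\<integral>x. F (merge I J (y, x)) \<partial>gauss_pi J) \<partial>gauss_pi I)"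
    using assms unfolding gauss_pi_def by (intro std_normal.product_integral_fold)
  interpret I: prob_space "gauss_pi I" by (rule prob_space_gauss_pi)
  interpret J: prob_space "gauss_pi J" by (rule prob_space_gauss_pi)
  interpret pair_sigma_finite "gauss_pi I" "gauss_pi J" ..
  have "integrable (distr (gauss_pi I \<Otimes>\<^sub>M gauss_pi J) (gauss_pi (I \<union> J)) (merge I J)) F"
    using F assms unfolding gauss_pi_def by (subst std_normal.distr_merge) auto
  then have "integrable (gauss_pi I \<Otimes>\<^sub>M gauss_pi J) (\<lambda>z. F (merge I J z))"
    using F unfolding gauss_pi_def by (subst (asm) integrable_distr_eq) auto
  from integrable_fst'[OF this]
  show "integrable (gauss_pi I) (\<lambda>y. \<integral>x. F (merge I J (y, x)) \<partial>gauss_pi J)" by simp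
qed

text \<open>Keys of the random variables in the columns \<open>J\<close>. In the application
  \<open>J = {m..<m+n}\<close>, so a column is labelled by its vertex and every key is already
  sorted, as \<open>gauss_idx\<close> requires.\<close>

definition cells :: "nat \<Rightarrow> nat set \<Rightarrow> (nat \<times> nat) set" where
  "cells m J = {..<m} \<times> J"

definition gcol :: "(nat \<Rightarrow> nat \<Rightarrow> real) \<Rightarrow> nat \<Rightarrow> (nat \<times> nat \<Rightarrow> real) \<Rightarrow> nat \<Rightarrow> real" where
  "gcol \<sigma> j x i = \<sigma> i j * x (i, j)"

text \<open>The base \<open>S\<close> is a parameter, so that a column whose value has been fixed
  can be absorbed into it.\<close>

definition gram :: "(nat \<Rightarrow> nat \<Rightarrow> real) \<Rightarrow> (nat \<Rightarrow> nat \<Rightarrow> real) \<Rightarrow> nat set \<Rightarrow> (nat \<times> nat \<Rightarrow> real) \<Rightarrow> nat \<Rightarrow> nat \<Rightarrow> real" where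
  "gram S \<sigma> J x i k = S i k + (\<Sum>j\<in>J. gcol \<sigma> j x i * gcol \<sigma> j x k)"

definition sdiag :: "real \<Rightarrow> nat \<Rightarrow> nat \<Rightarrow> real" where
  "sdiag t i k = (if i = k then t else 0)"

lemma finite_cells [simp]: "finite J \<Longrightarrow> finite (cells m J)"
  by (simp add: cells_def)

lemma gram_empty [simp]: "gram S \<sigma> {} x = S"
  by (simp add: gram_def fun_eq_iff)

lemma gram_insert:
  "finite J \<Longrightarrow> j \<notin> J \<Longrightarrow> gram S \<sigma> (insert j J) x = rank1_update (gram S \<sigma> J x) (gcol \<sigma> j x)"
  by (simp add: gram_def rank1_update_def fun_eq_iff)

lemma gram_rank1_update: "gram (rank1_update S c) \<sigma> J x = rank1_update (gram S \<sigma> J x) c"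
  by (simp add: gram_def rank1_update_def fun_eq_iff)

lemma pd_ge_gram:
  assumes "finite J" "pd_ge m t S"
  shows "pd_ge m t (gram S \<sigma> J x)" and "fdet m S \<le> fdet m (gram S \<sigma> J x)"
proof -
  have "pd_ge m t (gram S \<sigma> J x) \<and> fdet m S \<le> fdet m (gram S \<sigma> J x)"
    using assms
  proof (induction J)
    case (insert j J)
    then have IH: "pd_ge m t (gram S \<sigma> J x)" "fdet m S \<le> fdet m (gram S \<sigma> J x)" by auto
    note up = pd_ge_add_rank1[OF IH(1), where c = "gcol \<sigma> j x"]
    have "0 < fdet m (gram S \<sigma> J x)" using IH(1) by (simp add: pd_ge_def)
    then have "fdet m (gram S \<sigma> J x) * 1 \<le> fdet m (rank1_update (gram S \<sigma> J x) (gcol \<sigma> j x))"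
      unfolding up(2) using up(3) by (intro mult_left_mono) auto
    then show ?case using IH up(1) insert(1,2) by (simp add: gram_insert)
  qed simp
  then show "pd_ge m t (gram S \<sigma> J x)" "fdet m S \<le> fdet m (gram S \<sigma> J x)" by auto
qed

lemma has_moments_gram:
  assumes "cells m J \<subseteq> I" "i < m" "k < m"
  shows "has_moments (gauss_pi I) (\<lambda>x. gram S \<sigma> J x i k)"
proof -
  interpret prob_space "gauss_pi I" by (rule prob_space_gauss_pi)
  show ?thesis unfolding gram_def gcol_def
    using assms by (intro has_moments_add has_moments_sum has_moments_mult has_moments_const gauss_pi_has_moments)
      (auto simp: cells_def)
qed

lemma has_moments_fdet_gram:
  assumes "cells m J \<subseteq> I"
  shows "has_moments (gauss_pi I) (\<lambda>x. fdet m (gram S \<sigma> J x))"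
proof -
  interpret prob_space "gauss_pi I" by (rule prob_space_gauss_pi)
  show ?thesis using assms by (intro has_moments_fdet has_moments_gram)
qed

text \<open>The logarithm lies between the constant \<open>ln (fdet m S)\<close> and the determinant
  itself, which is integrable; the positive definite base excludes values near 0.\<close>

lemma integrable_ln_fdet_gram:
  assumes J: "finite J" "pd_ge m t S" and I: "cells m J \<subseteq> I"
  shows "integrable (gauss_pi I) (\<lambda>x. ln (fdet m (gram S \<sigma> J x)))"
proof -
  interpret prob_space "gauss_pi I" by (rule prob_space_gauss_pi)
  note mom = has_moments_fdet_gram[OF I, of S \<sigma>]
  have pos: "0 < fdet m S" using J by (simp add: pd_ge_def)
  have "integrable (gauss_pi I) (\<lambda>x. fdet m (gram S \<sigma> J x) + \<bar>ln (fdet m S)\<bar>)"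
    using has_moments_integrable[OF mom] by simp
  then show ?thesis
  proof (rule Bochner_Integration.integrable_bound)
    show "(\<lambda>x. ln (fdet m (gram S \<sigma> J x))) \<in> borel_measurable (gauss_pi I)"
      by (rule borel_measurable_ln[OF has_moments_measurable[OF mom]])
    show "AE x in gauss_pi I. norm (ln (fdet m (gram S \<sigma> J x))) \<le> norm (fdet m (gram S \<sigma> J x) + \<bar>ln (fdet m S)\<bar>)"
    proof (rule AE_I2)
      fix x
      define d where "d = fdet m (gram S \<sigma> J x)"
      have d: "fdet m S \<le> d" unfolding d_def by (rule pd_ge_gram[OF J])
      then have "ln (fdet m S) \<le> ln d" using pos by simp
      moreover have "ln d \<le> d - 1" using d pos by (intro ln_le_minus_one) auto
      ultimately have "\<bar>ln d\<bar> \<le> d + \<bar>ln (fdet m S)\<bar>" using d pos by linarith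
      then show "norm (ln (fdet m (gram S \<sigma> J x))) \<le> norm (fdet m (gram S \<sigma> J x) + \<bar>ln (fdet m S)\<bar>)"
        unfolding d_def[symmetric] by simp
    qed
  qed
qed

lemma gram_merge:
  assumes "i < m" "k < m" "J \<inter> J' = {}"
  shows "gram S \<sigma> J (merge (cells m J) (cells m J') (y, x)) i k = gram S \<sigma> J y i k"
    and "gram S \<sigma> J' (merge (cells m J) (cells m J') (y, x)) i k = gram S \<sigma> J' x i k"
proof -
  let ?z = "merge (cells m J) (cells m J') (y, x)"
  have "?z (l, j) = y (l, j)" if "l < m" "j \<in> J" for l j
    using that by (simp add: merge_def cells_def)
  then show "gram S \<sigma> J ?z i k = gram S \<sigma> J y i k"
    using assms unfolding gram_def gcol_def by simp
  have "?z (l, j) = x (l, j)" if "l < m" "j \<in> J'" for l j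
    using that assms(3) by (auto simp: merge_def cells_def)
  then show "gram S \<sigma> J' ?z i k = gram S \<sigma> J' x i k"
    using assms unfolding gram_def gcol_def by simp
qed

section \<open>The Jensen gap of the log-determinant\<close>

lemma trace_minv_bounds:
  assumes "pd_ge m t S"
  shows "0 \<le> trace_on m (minv m S)" "trace_on m (minv m S) \<le> m / t"
proof -
  have psd: "psd_le m (1 / t) (minv m S)" using assms by (simp add: pd_ge_def)
  show "0 \<le> trace_on m (minv m S)"
    unfolding trace_on_def using psd_diag[OF psd] by (intro sum_nonneg) auto
  have "trace_on m (minv m S) \<le> (\<Sum>i<m. 1 / t)"
    unfolding trace_on_def using psd_diag[OF psd] by (intro sum_mono) auto
  then show "trace_on m (minv m S) \<le> m / t" by simp
qed

text \<open>Conjugation by the diagonal matrix of standard deviations turns a form in a weighted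
  Gaussian column into a form in standard Gaussians, at the price of a factor
  \<open>a\<^sup>2\<close> in the norm.\<close>

lemma psd_le_weighted:
  assumes Q: "psd_le m r Q" and s: "\<And>i. i < m \<Longrightarrow> \<bar>s i\<bar> \<le> a" and r: "0 \<le> r"
  shows "psd_le m (a\<^sup>2 * r) (\<lambda>i k. s i * s k * Q i k)"
    and "qform m Q (\<lambda>i. s i * v i) = qform m (\<lambda>i k. s i * s k * Q i k) v"
proof -
  show eq: "qform m Q (\<lambda>i. s i * v i) = qform m (\<lambda>i k. s i * s k * Q i k) v" for v
    unfolding qform_def by (simp add: mult_ac)
  show "psd_le m (a\<^sup>2 * r) (\<lambda>i k. s i * s k * Q i k)"
    unfolding psd_le_def
  proof (intro conjI allI)
    show "sym_on m (\<lambda>i k. s i * s k * Q i k)" using Q by (auto simp: psd_le_def sym_on_def)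
    fix v
    show "0 \<le> qform m (\<lambda>i k. s i * s k * Q i k) v"
      unfolding eq[symmetric] using Q by (simp add: psd_le_def)
    have "qform m Q (\<lambda>i. s i * v i) \<le> r * (\<Sum>i<m. (s i * v i)\<^sup>2)"
      using Q by (simp add: psd_le_def)
    also have "(\<Sum>i<m. (s i * v i)\<^sup>2) \<le> (\<Sum>i<m. a\<^sup>2 * (v i)\<^sup>2)"
    proof (rule sum_mono)
      fix i assume "i \<in> {..<m}"
      then have "(s i)\<^sup>2 \<le> a\<^sup>2" using s[of i] by (metis lessThan_iff abs_ge_zero order_trans abs_le_square_iff abs_of_nonneg)
      then show "(s i * v i)\<^sup>2 \<le> a\<^sup>2 * (v i)\<^sup>2" by (simp add: power_mult_distrib mult_right_mono)
    qed
    then have "r * (\<Sum>i<m. (s i * v i)\<^sup>2) \<le> r * (\<Sum>i<m. a\<^sup>2 * (v i)\<^sup>2)"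
      using r by (rule mult_left_mono)
    also have "\<dots> = a\<^sup>2 * r * (\<Sum>i<m. (v i)\<^sup>2)" by (simp add: sum_distrib_left mult_ac)
    finally show "qform m (\<lambda>i k. s i * s k * Q i k) v \<le> a\<^sup>2 * r * (\<Sum>i<m. (v i)\<^sup>2)"
      unfolding eq .
  qed
qed

lemma trace_weighted_ge:
  assumes Q: "psd_le m r Q" and s: "\<And>i. i < m \<Longrightarrow> b \<le> s i" and b: "0 \<le> b"
  shows "b\<^sup>2 * trace_on m Q \<le> trace_on m (\<lambda>i k. s i * s k * Q i k)"
  unfolding trace_on_def sum_distrib_left
proof (rule sum_mono)
  fix i assume "i \<in> {..<m}"
  then have "b\<^sup>2 \<le> (s i)\<^sup>2" "0 \<le> Q i i" using s[of i] b psd_diag[OF Q, of i] by auto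
  then show "b\<^sup>2 * Q i i \<le> s i * s i * Q i i"
    by (simp add: mult_right_mono power2_eq_square)
qed

lemma cells_insert: "cells m (insert j J) = cells m {j} \<union> cells m J"
  by (auto simp: cells_def)

lemma column_cells:
  "inj_on (\<lambda>i. (i, j)) {..<m}" "(\<lambda>i. (i, j)) ` {..<m} \<subseteq> cells m {j}"
  by (auto simp: inj_on_def cells_def)

text \<open>Integrating \<open>fdet m (\<dots> + c c\<^sup>T)\<close> over the other columns leaves a positive constant plus a
  positive semidefinite form in \<open>c\<close> whose ratio to the constant is still at most \<open>1 / t\<close>.\<close>

lemma gram_mixture:
  assumes J: "finite J" and S: "pd_ge m t S"
  obtains \<alpha> Q where "0 < \<alpha>" "psd_le m (1 / t) Q"
    "\<And>c. (\<integral>x. fdet m (gram (rank1_update S c) \<sigma> J x) \<partial>gauss_pi (cells m J)) = \<alpha> * (1 + qform m Q c)"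
proof -
  interpret prob_space "gauss_pi (cells m J)" by (rule prob_space_gauss_pi)
  define d where "d x = fdet m (gram S \<sigma> J x)" for x
  define R where "R x = minv m (gram S \<sigma> J x)" for x
  have pd: "pd_ge m t (gram S \<sigma> J x)" for x by (rule pd_ge_gram[OF J S])
  have d0: "0 < d x" for x using pd by (simp add: d_def pd_ge_def)
  have dS: "fdet m S \<le> d x" for x unfolding d_def by (rule pd_ge_gram[OF J S])
  have S0: "0 < fdet m S" using S by (simp add: pd_ge_def)
  have psd: "psd_le m (1 / t) (R x)" for x using pd by (simp add: R_def pd_ge_def)
  have up: "fdet m (gram (rank1_update S c) \<sigma> J x) = d x * (1 + qform m (R x) c)" for c x
    unfolding gram_rank1_update d_def R_def by (rule pd_ge_add_rank1(2)[OF pd])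
  have int_det: "integrable (gauss_pi (cells m J)) (\<lambda>x. fdet m (gram S' \<sigma> J x))" for S'
    by (rule has_moments_integrable[OF has_moments_fdet_gram[OF order_refl]])
  have int_d: "integrable (gauss_pi (cells m J)) d"
    unfolding d_def by (rule int_det)
  define \<alpha> where "\<alpha> = expectation d"
  have "expectation (\<lambda>_. fdet m S) \<le> \<alpha>"
    unfolding \<alpha>_def by (rule integral_mono[OF _ int_d dS]) simp
  then have \<alpha>: "0 < \<alpha>" using S0 by (simp add: prob_space)
  have int_dR: "integrable (gauss_pi (cells m J)) (\<lambda>x. d x * R x i k)" for i k
  proof -
    \<comment> \<open>The denominator of \<open>minv\<close> cancels against \<open>d x\<close>,
      leaving a combination of determinants, which are integrable.\<close>
    have "(\<lambda>x. d x * R x i k) = (\<lambda>x. (fdet m (gram (rank1_update S (\<lambda>l. evec i l + evec k l)) \<sigma> J x)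
        - fdet m (gram (rank1_update S (evec i)) \<sigma> J x)
        - fdet m (gram (rank1_update S (evec k)) \<sigma> J x) + fdet m (gram S \<sigma> J x)) / 2)"
      using d0 less_imp_neq[OF d0] unfolding R_def minv_def gram_rank1_update d_def by (auto simp: fun_eq_iff)
    then show ?thesis using int_det by simp
  qed
  \<comment> \<open>The average of the inverses \<open>R x\<close> under the probability density
    \<open>d x / \<alpha>\<close>; the Loewner bounds survive this averaging.\<close>
  define Q where "Q i k = expectation (\<lambda>x. d x * R x i k) / \<alpha>" for i k
  have int_q: "integrable (gauss_pi (cells m J)) (\<lambda>x. d x * qform m (R x) v)" for v
  proof -
    have "(\<lambda>x. d x * qform m (R x) v) = (\<lambda>x. \<Sum>i<m. \<Sum>k<m. v i * v k * (d x * R x i k))"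
      unfolding qform_def by (simp add: sum_distrib_left mult_ac)
    then show ?thesis using int_dR by (simp add: Bochner_Integration.integrable_sum)
  qed
  have qQ: "\<alpha> * qform m Q v = expectation (\<lambda>x. d x * qform m (R x) v)" for v
  proof -
    have "(\<lambda>x. d x * qform m (R x) v) = (\<lambda>x. \<Sum>i<m. \<Sum>k<m. v i * v k * (d x * R x i k))"
      unfolding qform_def by (simp add: sum_distrib_left mult_ac)
    then have "expectation (\<lambda>x. d x * qform m (R x) v) = (\<Sum>i<m. \<Sum>k<m. expectation (\<lambda>x. v i * v k * (d x * R x i k)))"
      using int_dR by (simp add: integral_double_sum)
    also have "\<dots> = (\<Sum>i<m. \<Sum>k<m. v i * v k * expectation (\<lambda>x. d x * R x i k))"
      by simp
    also have "\<dots> = \<alpha> * qform m Q v"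
      using \<alpha> unfolding qform_def Q_def by (simp add: sum_distrib_left mult_ac)
    finally show ?thesis ..
  qed
  have "psd_le m (1 / t) Q"
    unfolding psd_le_def
  proof (intro conjI allI)
    show "sym_on m Q"
      unfolding sym_on_def
    proof (intro allI impI)
      fix i k assume "i < m" "k < m"
      then have "R x i k = R x k i" for x using psd[of x] by (simp add: psd_le_def sym_on_def)
      then show "Q i k = Q k i" by (simp add: Q_def)
    qed
    fix v
    have "0 \<le> expectation (\<lambda>x. d x * qform m (R x) v)"
      using d0 psd by (intro Bochner_Integration.integral_nonneg) (auto simp: psd_le_def less_imp_le)
    then show "0 \<le> qform m Q v" using \<alpha> unfolding qQ[symmetric] by (simp add: zero_le_mult_iff)
    have "\<alpha> * qform m Q v \<le> expectation (\<lambda>x. d x * (1 / t * (\<Sum>i<m. (v i)\<^sup>2)))"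
      unfolding qQ using d0 psd int_d
      by (intro integral_mono[OF int_q] mult_left_mono) (auto simp: psd_le_def less_imp_le)
    also have "\<dots> = \<alpha> * (1 / t * (\<Sum>i<m. (v i)\<^sup>2))" unfolding \<alpha>_def by simp
    finally show "qform m Q v \<le> 1 / t * (\<Sum>i<m. (v i)\<^sup>2)" using \<alpha> by (simp only: mult_le_cancel_left_pos)
  qed
  moreover have "expectation (\<lambda>x. fdet m (gram (rank1_update S c) \<sigma> J x)) = \<alpha> * (1 + qform m Q c)" for c
  proof -
    have "expectation (\<lambda>x. fdet m (gram (rank1_update S c) \<sigma> J x)) = expectation (\<lambda>x. d x + d x * qform m (R x) c)"
      unfolding up by (simp add: distrib_left)
    also have "\<dots> = \<alpha> + \<alpha> * qform m Q c"
      using int_d int_q qQ[of c] by (simp add: \<alpha>_def)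
    finally show ?thesis by (simp add: distrib_left)
  qed
  ultimately show ?thesis using that \<alpha> by blast
qed

text \<open>\<open>S\<close> varies in the induction because revealing column \<open>j\<close> moves
  it into the base. With the other columns averaged out, exchanging \<open>ln\<close> and the
  expectation over column \<open>j\<close> costs at most \<open>2 * (a\<^sup>2 / t)\<close>; for
  each fixed value of that column the induction hypothesis handles the rest.\<close>

lemma ln_expectation_gram_le:
  assumes "finite J" "pd_ge m t S" and "\<And>i j. i < m \<Longrightarrow> j \<in> J \<Longrightarrow> \<bar>\<sigma> i j\<bar> \<le> a"
  shows "ln (\<integral>x. fdet m (gram S \<sigma> J x) \<partial>gauss_pi (cells m J))
    \<le> (\<integral>x. ln (fdet m (gram S \<sigma> J x)) \<partial>gauss_pi (cells m J)) + 2 * (a\<^sup>2 / t) * card J"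
  using assms
proof (induction J arbitrary: S)
  case empty
  interpret prob_space "gauss_pi (cells m {})" by (rule prob_space_gauss_pi)
  show ?case by (simp add: prob_space)
next
  case (insert j J)
  define r where "r = a\<^sup>2 / t"
  let ?I = "cells m {j}" and ?J = "cells m J"
  interpret I: prob_space "gauss_pi ?I" by (rule prob_space_gauss_pi)
  have S: "pd_ge m t S" by fact
  have t: "0 < t" using S by (simp add: pd_ge_def)
  have disj: "{j} \<inter> J = {}" "?I \<inter> ?J = {}" using insert(2) by (auto simp: cells_def)
  have fin: "finite ?I" "finite ?J" using insert(1) by auto
  have split: "cells m (insert j J) = ?I \<union> ?J" by (rule cells_insert)
  have F: "fdet m (gram S \<sigma> (insert j J) (merge ?I ?J (y, x))) = fdet m (gram (rank1_update S (gcol \<sigma> j y)) \<sigma> J x)" for x y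
  proof (rule fdet_cong)
    fix i k assume ik: "i < m" "k < m"
    have "merge ?I ?J (y, x) (l, j) = y (l, j)" if "l < m" for l
      using that by (simp add: merge_def cells_def)
    then show "gram S \<sigma> (insert j J) (merge ?I ?J (y, x)) i k = gram (rank1_update S (gcol \<sigma> j y)) \<sigma> J x i k"
      using ik insert(1,2) gram_merge(2)[OF ik disj(1), of S \<sigma> y x]
      by (simp add: gram_insert gram_rank1_update rank1_update_def gcol_def)
  qed
  obtain \<alpha> Q where \<alpha>: "0 < \<alpha>" and Q: "psd_le m (1 / t) Q"
    and mix: "\<And>c. (\<integral>x. fdet m (gram (rank1_update S c) \<sigma> J x) \<partial>gauss_pi ?J) = \<alpha> * (1 + qform m Q c)"
    using gram_mixture[OF insert(1) S, where \<sigma> = \<sigma>] by blast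
  define Q' where "Q' = (\<lambda>i k. \<sigma> i j * \<sigma> k j * Q i k)"
  define h where "h y = \<alpha> * (1 + qform m Q' (\<lambda>i. y (i, j)))" for y :: "nat \<times> nat \<Rightarrow> real"
  have Q': "psd_le m r Q'" and qQ': "qform m Q (gcol \<sigma> j y) = qform m Q' (\<lambda>i. y (i, j))" for y
    using psd_le_weighted[OF Q, of "\<lambda>i. \<sigma> i j" a] insert.prems(2) t
    unfolding Q'_def gcol_def r_def by auto
  have r: "0 \<le> r" using t by (simp add: r_def)
  note quad = gauss_psd_quadratic[OF fin(1) column_cells Q' r]
  have int_F: "integrable (gauss_pi (?I \<union> ?J)) (\<lambda>x. fdet m (gram S \<sigma> (insert j J) x))"
    unfolding split[symmetric] by (rule has_moments_integrable[OF has_moments_fdet_gram[OF order_refl]])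
  have int_lnF: "integrable (gauss_pi (?I \<union> ?J)) (\<lambda>x. ln (fdet m (gram S \<sigma> (insert j J) x)))"
    unfolding split[symmetric] using insert.hyps S by (intro integrable_ln_fdet_gram) auto
  have nnQ': "0 \<le> qform m Q' v" for v using Q' by (simp add: psd_le_def)
  have tr0: "0 \<le> trace_on m Q'" using psd_diag[OF Q'] unfolding trace_on_def by (intro sum_nonneg) auto
  have "(\<integral>x. fdet m (gram S \<sigma> (insert j J) x) \<partial>gauss_pi (cells m (insert j J))) = (\<integral>y. h y \<partial>gauss_pi ?I)"
    unfolding split gauss_pi_fold(2)[OF disj(2) fin int_F] F mix qQ' h_def ..
  also have "\<dots> = \<alpha> * (1 + trace_on m Q')"
    unfolding h_def using quad(5,6) by (simp add: I.prob_space)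
  finally have "ln (\<integral>x. fdet m (gram S \<sigma> (insert j J) x) \<partial>gauss_pi (cells m (insert j J))) = ln \<alpha> + ln (1 + trace_on m Q')"
    using \<alpha> tr0 by (simp add: ln_mult_pos)
  also have "\<dots> \<le> ln \<alpha> + (\<integral>y. ln (1 + qform m Q' (\<lambda>i. y (i, j))) \<partial>gauss_pi ?I) + 2 * r"
    using quad(4) by simp
  also have "ln \<alpha> + (\<integral>y. ln (1 + qform m Q' (\<lambda>i. y (i, j))) \<partial>gauss_pi ?I) = (\<integral>y. ln \<alpha> + ln (1 + qform m Q' (\<lambda>i. y (i, j))) \<partial>gauss_pi ?I)"
    using quad(3) by (simp add: I.prob_space)
  also have "\<dots> = (\<integral>y. ln (h y) \<partial>gauss_pi ?I)"
    unfolding h_def using \<alpha> nnQ' by (intro Bochner_Integration.integral_cong refl ln_mult_pos[symmetric]) (auto simp: add_pos_nonneg)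
  also have "(\<integral>y. ln (h y) \<partial>gauss_pi ?I) \<le> (\<integral>y. (\<integral>x. ln (fdet m (gram S \<sigma> (insert j J) (merge ?I ?J (y, x)))) \<partial>gauss_pi ?J) + 2 * r * card J \<partial>gauss_pi ?I)"
  proof (rule integral_mono)
    show "integrable (gauss_pi ?I) (\<lambda>y. ln (h y))"
    proof -
      have "(\<lambda>y. ln (h y)) = (\<lambda>y. ln \<alpha> + ln (1 + qform m Q' (\<lambda>i. y (i, j))))"
        unfolding h_def using \<alpha> nnQ' by (auto simp: fun_eq_iff ln_mult_pos add_pos_nonneg)
      then show ?thesis using quad(3) by simp
    qed
    show "integrable (gauss_pi ?I) (\<lambda>y. (\<integral>x. ln (fdet m (gram S \<sigma> (insert j J) (merge ?I ?J (y, x)))) \<partial>gauss_pi ?J) + 2 * r * card J)"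
      using gauss_pi_fold(1)[OF disj(2) fin int_lnF] by simp
    fix y
    have "pd_ge m t (rank1_update S (gcol \<sigma> j y))" by (rule pd_ge_add_rank1(1)[OF S])
    from insert.IH[OF this] insert.prems(2)
    show "ln (h y) \<le> (\<integral>x. ln (fdet m (gram S \<sigma> (insert j J) (merge ?I ?J (y, x)))) \<partial>gauss_pi ?J) + 2 * r * card J"
      unfolding mix F h_def qQ' r_def by simp
  qed
  also have "\<dots> = (\<integral>x. ln (fdet m (gram S \<sigma> (insert j J) x)) \<partial>gauss_pi (cells m (insert j J))) + 2 * r * card J"
    unfolding split gauss_pi_fold(2)[OF disj(2) fin int_lnF]
    using gauss_pi_fold(1)[OF disj(2) fin int_lnF] by (simp add: I.prob_space)
  finally show ?case using insert.hyps unfolding r_def[symmetric] by (simp add: algebra_simps)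
qed


text \<open>The trace of the inverse times \<open>S - t I\<close>, computed twice. Directly it is
  \<open>m\<close> minus \<open>t\<close> times the trace of the inverse; as a sum over columns it
  is the sum of the forms \<open>1 - 1 / (1 + q j)\<close>.\<close>

lemma sum_leave_one_out:
  fixes \<sigma> x m
  assumes J: "finite J" and t: "0 < t"
  defines "S \<equiv> gram (sdiag t) \<sigma> J x"
  defines "q \<equiv> \<lambda>j. qform m (minv m (gram (sdiag t) \<sigma> (J - {j}) x)) (gcol \<sigma> j x)"
  shows "(\<Sum>j\<in>J. 1 / (1 + q j)) = card J - real m + t * trace_on m (minv m S)"
    and "j \<in> J \<Longrightarrow> trace_on m (minv m S) \<le> trace_on m (minv m (gram (sdiag t) \<sigma> (J - {j}) x))"
    and "0 \<le> q j"
proof -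
  define R where "R = minv m S"
  have D: "pd_ge m t (sdiag t)"
    using pd_ge_diag[OF t] by (simp add: sdiag_def[abs_def])
  have pd: "pd_ge m t (gram (sdiag t) \<sigma> (J - {j}) x)" for j
    using J by (intro pd_ge_gram D) auto
  have S_eq: "S = rank1_update (gram (sdiag t) \<sigma> (J - {j}) x) (gcol \<sigma> j x)" if "j \<in> J" for j
    using that J unfolding S_def by (subst gram_insert[symmetric]) (auto simp: insert_absorb)
  show "j \<in> J \<Longrightarrow> trace_on m (minv m S) \<le> trace_on m (minv m (gram (sdiag t) \<sigma> (J - {j}) x))"
    using trace_minv_add_rank1(2)[OF pd] S_eq by simp
  show "0 \<le> q j" using pd[of j] by (simp add: q_def pd_ge_def psd_le_def)
  have "inverse_pair m S R" "sym_on m R"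
    using pd_ge_gram(1)[OF J D, of \<sigma> x] unfolding R_def S_def by (auto simp: pd_ge_def psd_le_def)
  then have inv: "\<And>i k. i < m \<Longrightarrow> k < m \<Longrightarrow> (\<Sum>l<m. S i l * R l k) = (if i = k then 1 else 0)"
    and sym: "\<And>i k. i < m \<Longrightarrow> k < m \<Longrightarrow> R i k = R k i"
    unfolding inverse_pair_def sym_on_def by blast+
  have "(\<Sum>j\<in>J. 1 / (1 + q j)) = (\<Sum>j\<in>J. 1 - qform m R (gcol \<sigma> j x))"
    unfolding q_def R_def using qform_minv_add_rank1[OF pd] S_eq by (intro sum.cong) auto
  also have "\<dots> = card J - (\<Sum>j\<in>J. qform m R (gcol \<sigma> j x))"
    by (simp add: sum_subtractf)
  also have "(\<Sum>j\<in>J. qform m R (gcol \<sigma> j x)) = (\<Sum>i<m. \<Sum>k<m. R i k * (S i k - sdiag t i k))"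
  proof -
    have "(\<Sum>j\<in>J. qform m R (gcol \<sigma> j x)) = (\<Sum>i<m. \<Sum>k<m. \<Sum>j\<in>J. R i k * gcol \<sigma> j x i * gcol \<sigma> j x k)"
      unfolding qform_def by (subst sum.swap) (intro sum.cong refl sum.swap)
    then show ?thesis by (simp add: S_def gram_def sum_distrib_left mult.assoc)
  qed
  also have "\<dots> = (\<Sum>i<m. (\<Sum>k<m. S i k * R k i) - t * R i i)"
  proof (rule sum.cong[OF refl])
    fix i assume "i \<in> {..<m}"
    then have "(\<Sum>k<m. R i k * sdiag t i k) = t * R i i"
      by (simp add: sdiag_def mult_delta_right sum.delta)
    moreover have "(\<Sum>k<m. R i k * S i k) = (\<Sum>k<m. S i k * R k i)"
      using \<open>i \<in> {..<m}\<close> sym by (intro sum.cong) auto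
    ultimately show "(\<Sum>k<m. R i k * (S i k - sdiag t i k)) = (\<Sum>k<m. S i k * R k i) - t * R i i"
      by (simp add: right_diff_distrib sum_subtractf)
  qed
  also have "\<dots> = (\<Sum>i<m. 1 - t * R i i)"
    using inv by (intro sum.cong) auto
  also have "\<dots> = real m - t * trace_on m R"
    unfolding trace_on_def by (simp add: sum_subtractf sum_distrib_left)
  finally show "(\<Sum>j\<in>J. 1 / (1 + q j)) = card J - real m + t * trace_on m (minv m S)"
    by (simp add: R_def)
qed

lemma measurable_gram:
  assumes "cells m J \<subseteq> I" "i < m" "k < m"
  shows "(\<lambda>x. gram S \<sigma> J x i k) \<in> borel_measurable (gauss_pi I)"
  by (rule has_moments_measurable[OF has_moments_gram[OF assms]])

lemma measurable_trace_minv_gram: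
  assumes "cells m J \<subseteq> I"
  shows "(\<lambda>x. trace_on m (minv m (gram S \<sigma> J x))) \<in> borel_measurable (gauss_pi I)"
  unfolding trace_on_def
  by (intro borel_measurable_sum measurable_minv measurable_gram) (use assms in auto)

text \<open>A column is independent of the Gram matrix \<open>S\<^sub>j\<close> of the others, so \<open>E 1 / (1 + q j)\<close> is at most of
  order \<open>1 / tr S\<^sub>j\<inverse>\<close>; since \<open>tr S\<inverse> \<le> tr S\<^sub>j\<inverse>\<close>, summing over \<open>j\<close> turns
  the identity for \<open>\<Sum>j. 1 / (1 + q j)\<close> into a quadratic bound for \<open>tr S\<inverse>\<close> itself.\<close>

lemma expectation_trace_square:
  assumes J: "finite J" and t: "0 < t" and b: "0 < b" and mJ: "m \<le> card J"
    and \<sigma>: "\<And>i j. i < m \<Longrightarrow> j \<in> J \<Longrightarrow> b \<le> \<sigma> i j \<and> \<sigma> i j \<le> a"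
  defines "\<tau> \<equiv> \<lambda>x. trace_on m (minv m (gram (sdiag t) \<sigma> J x))"
  shows "integrable (gauss_pi (cells m J)) (\<lambda>x. (\<tau> x)\<^sup>2)"
    and "(\<integral>x. (\<tau> x)\<^sup>2 \<partial>gauss_pi (cells m J)) \<le> (1 + 2 * (a\<^sup>2 / t)) * card J / (t * b\<^sup>2)"
proof -
  interpret prob_space "gauss_pi (cells m J)" by (rule prob_space_gauss_pi)
  define r where "r = a\<^sup>2 / t"
  have r: "0 \<le> r" using t by (simp add: r_def)
  define Sj where "Sj j x = gram (sdiag t) \<sigma> (J - {j}) x" for j x
  define q where "q j x = qform m (minv m (Sj j x)) (gcol \<sigma> j x)" for j x
  \<comment> \<open>The first factor involves only the other columns and compensates the bound on
    the mean of \<open>1 / (1 + q j)\<close> given those columns, so that the product has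
    expectation at most \<open>1 + 2 * r\<close>.\<close>
  define g where "g j x = (1 + b\<^sup>2 * trace_on m (minv m (Sj j x))) * (1 / (1 + q j x))" for j x
  note loo = sum_leave_one_out[OF J t, where \<sigma> = \<sigma> and m = m, folded \<tau>_def Sj_def, folded q_def]
  have D: "pd_ge m t (sdiag t)"
    using pd_ge_diag[OF t] by (simp add: sdiag_def[abs_def])
  have pd: "pd_ge m t (Sj j x)" for j x
    unfolding Sj_def using J by (intro pd_ge_gram D) auto
  note tr = trace_minv_bounds[OF pd]
  have \<tau>: "0 \<le> \<tau> x" "\<tau> x \<le> m / t" for x
    unfolding \<tau>_def using trace_minv_bounds[OF pd_ge_gram(1)[OF J D]] by auto
  have meas_\<tau>: "\<tau> \<in> borel_measurable (gauss_pi (cells m J))"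
    unfolding \<tau>_def by (rule measurable_trace_minv_gram) simp
  show int_\<tau>: "integrable (gauss_pi (cells m J)) (\<lambda>x. (\<tau> x)\<^sup>2)"
  proof (rule integrable_const_bound)
    show "AE x in gauss_pi (cells m J). norm ((\<tau> x)\<^sup>2) \<le> (m / t)\<^sup>2"
      by (rule AE_I2) (use \<tau> in \<open>simp add: power_mono\<close>)
    show "(\<lambda>x. (\<tau> x)\<^sup>2) \<in> borel_measurable (gauss_pi (cells m J))"
      using meas_\<tau> by (rule borel_measurable_power)
  qed
  have meas_g: "g j \<in> borel_measurable (gauss_pi (cells m J))" if "j \<in> J" for j
    unfolding g_def q_def Sj_def qform_def gcol_def
    by (intro borel_measurable_times borel_measurable_add borel_measurable_const borel_measurable_divide
        borel_measurable_sum measurable_trace_minv_gram measurable_minv measurable_gram measurable_gauss_component)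
       (use that in \<open>auto simp: cells_def\<close>)
  have g0: "0 \<le> g j x" for j x
    unfolding g_def using tr(1)[of j x] loo(3)[where x=x and j=j] by (intro mult_nonneg_nonneg) auto
  have int_g: "integrable (gauss_pi (cells m J)) (g j)" if "j \<in> J" for j
  proof (rule integrable_const_bound[OF _ meas_g[OF that]])
    have "g j x \<le> (1 + b\<^sup>2 * (m / t)) * 1" for x
      unfolding g_def using tr[of j x] loo(3)[where x=x and j=j] t
      by (intro mult_mono add_left_mono mult_left_mono) (auto intro!: add_nonneg_nonneg)
    then show "AE x in gauss_pi (cells m J). norm (g j x) \<le> (1 + b\<^sup>2 * (m / t)) * 1"
      by (intro AE_I2) (use g0 in simp)
  qed
  have Eg: "expectation (g j) \<le> 1 + 2 * r" if j: "j \<in> J" for j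
  proof -
    let ?I = "cells m (J - {j})" and ?J = "cells m {j}"
    interpret I: prob_space "gauss_pi ?I" by (rule prob_space_gauss_pi)
    have disj: "(J - {j}) \<inter> {j} = {}" "?I \<inter> ?J = {}" by (auto simp: cells_def)
    have fin: "finite ?I" "finite ?J" using J by auto
    have split: "cells m J = ?I \<union> ?J" using j by (auto simp: cells_def)
    have int: "integrable (gauss_pi (?I \<union> ?J)) (g j)" using int_g[OF j] unfolding split .
    have inner: "(\<integral>x. g j (merge ?I ?J (y, x)) \<partial>gauss_pi ?J) \<le> 1 + 2 * r" for y
    proof -
      define P where "P = minv m (Sj j y)"
      define P' where "P' = (\<lambda>i k. \<sigma> i j * \<sigma> k j * P i k)"
      have psd: "psd_le m (1 / t) P" using pd[of j y] by (simp add: P_def pd_ge_def)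
      have ab: "\<bar>\<sigma> i j\<bar> \<le> a" if "i < m" for i
        using \<sigma>[OF that j] b by linarith
      note w = psd_le_weighted[of m "1 / t" P "\<lambda>i. \<sigma> i j" a, OF psd ab]
      have P': "psd_le m r P'" using w(1) t by (simp add: r_def P'_def)
      have qP': "qform m P (gcol \<sigma> j x) = qform m P' (\<lambda>i. x (i, j))" for x
        unfolding gcol_def P'_def using t by (intro w(2)) auto
      note quad = gauss_psd_quadratic[OF fin(2) column_cells P' r]
      \<comment> \<open>At the merged point the Gram matrix without column \<open>j\<close> is known
        to agree with \<open>Sj j y\<close> only on indices below \<open>m\<close>; uniqueness of
        the inverse is enough for the entries needed.\<close>
      have eq: "minv m (Sj j (merge ?I ?J (y, x))) i k = P i k" if "i < m" "k < m" for i k x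
      proof (rule minv_eqI[OF _ _ _ that])
        have same: "Sj j (merge ?I ?J (y, x)) i k = Sj j y i k" if "i < m" "k < m" for i k
          unfolding Sj_def by (rule gram_merge(1)[OF that disj(1)])
        have "inverse_pair m (Sj j y) P" using pd[of j y] by (simp add: P_def pd_ge_def)
        then show "inverse_pair m (Sj j (merge ?I ?J (y, x))) P"
          unfolding inverse_pair_def using same by simp
        show "sym_on m P" using psd by (simp add: psd_le_def)
        show "fdet m (Sj j (merge ?I ?J (y, x))) \<noteq> 0"
          using pd[of j "merge ?I ?J (y, x)"] by (simp add: pd_ge_def)
      qed
      have col: "gcol \<sigma> j (merge ?I ?J (y, x)) i = gcol \<sigma> j x i" if "i < m" for i x
        using that by (simp add: gcol_def merge_def cells_def)
      have qm: "q j (merge ?I ?J (y, x)) = qform m P' (\<lambda>i. x (i, j))" for x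
        unfolding q_def qP'[symmetric] by (rule qform_cong) (auto simp: eq col)
      have tm: "trace_on m (minv m (Sj j (merge ?I ?J (y, x)))) = trace_on m P" for x
        unfolding trace_on_def by (intro sum.cong) (auto simp: eq)
      have tr': "0 \<le> trace_on m P" "b\<^sup>2 * trace_on m P \<le> trace_on m P'"
        using tr(1)[of j y] trace_weighted_ge[OF psd, of b "\<lambda>i. \<sigma> i j"] \<sigma> j b by (auto simp: P_def P'_def)
      have tr'': "0 \<le> trace_on m P'" using tr' by (smt (verit) mult_nonneg_nonneg zero_le_power2)
      have nn: "0 \<le> (\<integral>x. 1 / (1 + qform m P' (\<lambda>i. x (i, j))) \<partial>gauss_pi ?J)"
        using P' by (intro Bochner_Integration.integral_nonneg) (auto simp: psd_le_def)
      have "(\<integral>x. g j (merge ?I ?J (y, x)) \<partial>gauss_pi ?J)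
          = (1 + b\<^sup>2 * trace_on m P) * (\<integral>x. 1 / (1 + qform m P' (\<lambda>i. x (i, j))) \<partial>gauss_pi ?J)"
        unfolding g_def qm tm by (rule integral_mult_right_zero)
      also have "\<dots> \<le> (1 + trace_on m P') * ((1 + 2 * r) / (1 + trace_on m P'))"
        using tr' tr'' nn by (intro mult_mono quad(2)) auto
      also have "\<dots> = 1 + 2 * r" using tr'' by simp
      finally show ?thesis .
    qed
    have "expectation (g j) = (\<integral>y. (\<integral>x. g j (merge ?I ?J (y, x)) \<partial>gauss_pi ?J) \<partial>gauss_pi ?I)"
      unfolding split by (rule gauss_pi_fold(2)[OF disj(2) fin int])
    also have "\<dots> \<le> (\<integral>y. 1 + 2 * r \<partial>gauss_pi ?I)"
      by (rule integral_mono[OF gauss_pi_fold(1)[OF disj(2) fin int] _ inner]) simp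
    also have "\<dots> = 1 + 2 * r" by (simp add: I.prob_space)
    finally show ?thesis .
  qed
  have "t * b\<^sup>2 * (\<tau> x)\<^sup>2 \<le> (\<Sum>j\<in>J. g j x)" for x
  proof -
    have "t * b\<^sup>2 * (\<tau> x)\<^sup>2 = (b\<^sup>2 * \<tau> x) * (t * \<tau> x)" by (simp add: power2_eq_square mult_ac)
    \<comment> \<open>Both factors are enlarged, the second by \<open>card J - m\<close>, which is
      nonnegative by \<open>mJ\<close>; it then equals the sum over all columns in the leave-one-out
      identity.\<close>
    also have "\<dots> \<le> (1 + b\<^sup>2 * \<tau> x) * (card J - real m + t * \<tau> x)"
      using \<tau>[of x] mJ t by (intro mult_mono) auto
    also have "\<dots> = (\<Sum>j\<in>J. (1 + b\<^sup>2 * \<tau> x) * (1 / (1 + q j x)))"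
      unfolding sum_distrib_left[symmetric] loo(1) by (simp add: \<tau>_def)
    also have "\<dots> \<le> (\<Sum>j\<in>J. g j x)"
      unfolding g_def \<tau>_def using loo(2,3) by (intro sum_mono mult_right_mono add_left_mono mult_left_mono) auto
    finally show ?thesis .
  qed
  then have "expectation (\<lambda>x. t * b\<^sup>2 * (\<tau> x)\<^sup>2) \<le> expectation (\<lambda>x. \<Sum>j\<in>J. g j x)"
    using int_\<tau> int_g by (intro integral_mono) auto
  also have "\<dots> = (\<Sum>j\<in>J. expectation (g j))"
    using int_g by (rule Bochner_Integration.integral_sum)
  also have "\<dots> \<le> (\<Sum>j\<in>J. 1 + 2 * r)" by (intro sum_mono Eg)
  finally have "(t * b\<^sup>2) * expectation (\<lambda>x. (\<tau> x)\<^sup>2) \<le> (1 + 2 * r) * card J"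
    by (simp add: mult.commute)
  then show "expectation (\<lambda>x. (\<tau> x)\<^sup>2) \<le> (1 + 2 * (a\<^sup>2 / t)) * card J / (t * b\<^sup>2)"
    using t b by (simp add: pos_le_divide_eq r_def mult.commute)
qed

text \<open>Going up from \<open>t\<close> to \<open>T\<close> inside the expectation is free, since
  the determinant is monotone; only the way back, for the expected logarithm, costs
  \<open>(T - t)\<close> times the mean trace.\<close>

lemma ln_expectation_gap:
  assumes J: "finite J" and t: "0 < t" "t \<le> T" and b: "0 < b" and mJ: "m \<le> card J"
    and \<sigma>: "\<And>i j. i < m \<Longrightarrow> j \<in> J \<Longrightarrow> b \<le> \<sigma> i j \<and> \<sigma> i j \<le> a"
  shows "ln (\<integral>x. fdet m (gram (sdiag t) \<sigma> J x) \<partial>gauss_pi (cells m J))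
    \<le> (\<integral>x. ln (fdet m (gram (sdiag t) \<sigma> J x)) \<partial>gauss_pi (cells m J))
      + 2 * (a\<^sup>2 / T) * card J + (T - t) * (((1 + 2 * (a\<^sup>2 / t)) / (t * b\<^sup>2) + 1) / 2 * sqrt (card J))"
proof (cases "card J = 0")
  case True
  then have "J = {}" "m = 0" using J mJ by auto
  interpret prob_space "gauss_pi (cells 0 {})" by (rule prob_space_gauss_pi)
  show ?thesis using \<open>J = {}\<close> \<open>m = 0\<close> by (simp add: prob_space)
next
  case False
  define n where "n = real (card J)"
  define K where "K = (1 + 2 * (a\<^sup>2 / t)) / (t * b\<^sup>2)"
  have n: "0 < n" using False by (simp add: n_def)
  let ?G = "gauss_pi (cells m J)"
  interpret prob_space ?G by (rule prob_space_gauss_pi)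
  define \<tau> where "\<tau> x = trace_on m (minv m (gram (sdiag t) \<sigma> J x))" for x
  note \<tau>2 = expectation_trace_square[where \<sigma> = \<sigma>, OF J t(1) b mJ \<sigma>, folded \<tau>_def, folded n_def]
  have T: "0 < T" using t by simp
  have Dt: "pd_ge m t (sdiag t)" and DT: "pd_ge m T (sdiag T)"
    using pd_ge_diag[OF t(1)] pd_ge_diag[OF T] by (simp_all add: sdiag_def[abs_def])
  have pd: "pd_ge m t (gram (sdiag t) \<sigma> J x)" for x by (rule pd_ge_gram[OF J Dt])
  have \<tau>0: "0 \<le> \<tau> x" "\<tau> x \<le> m / t" for x
    unfolding \<tau>_def using trace_minv_bounds[OF pd] by auto
  have int_\<tau>: "integrable ?G \<tau>"
  proof (rule integrable_const_bound)
    show "AE x in ?G. norm (\<tau> x) \<le> m / t" by (rule AE_I2) (use \<tau>0 in simp)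
    show "\<tau> \<in> borel_measurable ?G" unfolding \<tau>_def[abs_def] by (rule measurable_trace_minv_gram) simp
  qed
  \<comment> \<open>The arithmetic-geometric mean inequality with weight \<open>sqrt n\<close>,
    which balances the two terms because the second moment is at most \<open>K * n\<close>.\<close>
  have "expectation \<tau> \<le> expectation (\<lambda>x. ((\<tau> x)\<^sup>2 / sqrt n + sqrt n) / 2)"
  proof (rule integral_mono[OF int_\<tau>])
    show "integrable ?G (\<lambda>x. ((\<tau> x)\<^sup>2 / sqrt n + sqrt n) / 2)" using \<tau>2(1) by simp
    fix x
    define w where "w = sqrt n"
    have w: "0 < w" using n by (simp add: w_def)
    have "\<tau> x = 2 * \<tau> x * w / (2 * w)" using w by simp
    also have "\<dots> \<le> ((\<tau> x)\<^sup>2 + w\<^sup>2) / (2 * w)"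
      using w by (intro divide_right_mono sum_squares_bound) auto
    also have "\<dots> = ((\<tau> x)\<^sup>2 / w + w) / 2"
      using w by (simp add: power2_eq_square add_divide_distrib)
    finally show "\<tau> x \<le> ((\<tau> x)\<^sup>2 / sqrt n + sqrt n) / 2" unfolding w_def .
  qed
  also have "\<dots> = (expectation (\<lambda>x. (\<tau> x)\<^sup>2) / sqrt n + sqrt n) / 2"
    using \<tau>2(1) by (simp add: prob_space)
  also have "\<dots> \<le> (K * n / sqrt n + sqrt n) / 2"
    using \<tau>2(2) n unfolding K_def by (intro divide_right_mono add_right_mono) auto
  also have "\<dots> = (K + 1) / 2 * sqrt n"
  proof -
    have "K * n / sqrt n = K * sqrt n"
      using real_div_sqrt[of n] n by (metis times_divide_eq_right less_imp_le)
    then show ?thesis by (simp add: distrib_right)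
  qed
  finally have E\<tau>: "expectation \<tau> \<le> (K + 1) / 2 * sqrt n" .
  have eq: "fdet m (gram (sdiag T) \<sigma> J x) = fdet m (\<lambda>i k. gram (sdiag t) \<sigma> J x i k + (if i = k then T - t else 0))" for x
    by (rule fdet_cong) (simp add: gram_def sdiag_def)
  have Tt: "0 \<le> T - t" using t by simp
  note up = ln_fdet_add_diag[OF pd Tt, folded eq \<tau>_def]
  have int_det: "integrable ?G (\<lambda>x. fdet m (gram (sdiag u) \<sigma> J x))" for u
    by (rule has_moments_integrable[OF has_moments_fdet_gram]) simp
  have int_ln: "integrable ?G (\<lambda>x. ln (fdet m (gram (sdiag u) \<sigma> J x)))" if "0 < u" for u
    using pd_ge_diag[OF that] by (intro integrable_ln_fdet_gram[OF J, of m u]) (auto simp: sdiag_def[abs_def])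
  have "0 < fdet m (sdiag t)" using Dt by (simp add: pd_ge_def)
  also have "\<dots> = expectation (\<lambda>_. fdet m (sdiag t))" by (simp add: prob_space)
  also have "\<dots> \<le> expectation (\<lambda>x. fdet m (gram (sdiag t) \<sigma> J x))"
    by (rule integral_mono[OF _ int_det pd_ge_gram(2)[OF J Dt]]) simp
  finally have pos: "0 < expectation (\<lambda>x. fdet m (gram (sdiag t) \<sigma> J x))" .
  have "expectation (\<lambda>x. fdet m (gram (sdiag t) \<sigma> J x)) \<le> expectation (\<lambda>x. fdet m (gram (sdiag T) \<sigma> J x))"
    by (rule integral_mono[OF int_det int_det up(2)])
  then have "ln (expectation (\<lambda>x. fdet m (gram (sdiag t) \<sigma> J x))) \<le> ln (expectation (\<lambda>x. fdet m (gram (sdiag T) \<sigma> J x)))"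
    using pos by (intro ln_mono) auto
  also have "\<dots> \<le> expectation (\<lambda>x. ln (fdet m (gram (sdiag T) \<sigma> J x))) + 2 * (a\<^sup>2 / T) * n"
    unfolding n_def using \<sigma> b by (intro ln_expectation_gram_le[OF J DT]) fastforce
  also have "expectation (\<lambda>x. ln (fdet m (gram (sdiag T) \<sigma> J x)))
      \<le> expectation (\<lambda>x. ln (fdet m (gram (sdiag t) \<sigma> J x)) + (T - t) * \<tau> x)"
    using int_ln[OF t(1)] int_\<tau> by (intro integral_mono[OF int_ln[OF T] _ up(1)]) auto
  also have "\<dots> = expectation (\<lambda>x. ln (fdet m (gram (sdiag t) \<sigma> J x))) + (T - t) * expectation \<tau>"
    using int_ln[OF t(1)] int_\<tau> by simp
  also have "(T - t) * expectation \<tau> \<le> (T - t) * ((K + 1) / 2 * sqrt n)"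
    using Tt E\<tau> by (intro mult_left_mono)
  finally show ?thesis unfolding K_def n_def by simp
qed

section \<open>Matchings and the expected determinant\<close>

definition moved :: "nat \<Rightarrow> (nat \<Rightarrow> nat) \<Rightarrow> nat set" where
  "moved N p = {i\<in>{0..<N}. p i \<noteq> i}"

text \<open>For an involution these are its 2-cycles, hence a matching; both ends of a 2-cycle give
  the same edge.\<close>

definition perm_edges :: "nat \<Rightarrow> (nat \<Rightarrow> nat) \<Rightarrow> nat set set" where
  "perm_edges N p = (\<lambda>i. {i, p i}) ` moved N p"

definition sorted_pair :: "nat \<Rightarrow> nat \<Rightarrow> nat \<times> nat" where
  "sorted_pair i k = (min i k, max i k)"

lemma sorted_pair_eq_iff: "sorted_pair i k = sorted_pair i' k' \<longleftrightarrow> (i = i' \<and> k = k') \<or> (i = k' \<and> k = i')"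
  unfolding sorted_pair_def by (auto simp: min_def max_def)

lemma finite_gauss_idx [simp]: "finite (gauss_idx N)"
  by (rule finite_subset[of _ "{..<N} \<times> {..<N}"]) (auto simp: gauss_idx_def)

lemma sorted_pair_in_gauss_idx: "i < N \<Longrightarrow> k < N \<Longrightarrow> sorted_pair i k \<in> gauss_idx N"
  by (auto simp: sorted_pair_def gauss_idx_def)

text \<open>Each off-diagonal variable \<open>x (i, k)\<close> occurs as often as \<open>p i = k\<close> or \<open>p k = i\<close>; the expectation
  survives only if every such variable occurs twice, i.e. if \<open>p\<close> is an involution.\<close>

lemma expectation_perm_term:
  assumes p: "p permutes {0..<N}"
  shows "(\<integral>x. (\<Prod>i\<in>moved N p. x (sorted_pair i (p i))) \<partial>gauss_pi (gauss_idx N)) = of_bool (\<forall>i. p (p i) = i)"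
proof -
  let ?I = "gauss_idx N"
  have pN: "p i < N" if "i < N" for i using permutes_in_image[OF p, of i] that by simp
  have fin: "finite (moved N p)" by (simp add: moved_def)
  define k where "k z = card {i\<in>moved N p. sorted_pair i (p i) = z}" for z
  have eq: "(\<Prod>i\<in>moved N p. x (sorted_pair i (p i))) = (\<Prod>z\<in>?I. x z ^ k z)" for x :: "nat \<times> nat \<Rightarrow> real"
  proof -
    have "(\<Prod>z\<in>?I. \<Prod>i\<in>{i\<in>moved N p. sorted_pair i (p i) = z}. x (sorted_pair i (p i))) = (\<Prod>i\<in>moved N p. x (sorted_pair i (p i)))"
      by (rule prod.group[OF fin finite_gauss_idx]) (auto simp: moved_def intro!: sorted_pair_in_gauss_idx pN)
    moreover have "(\<Prod>i\<in>{i\<in>moved N p. sorted_pair i (p i) = z}. x (sorted_pair i (p i))) = x z ^ k z" for z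
      unfolding k_def by (subst prod_constant[symmetric]) (rule prod.cong, auto)
    ultimately show ?thesis by simp
  qed
  have val: "(\<integral>x. (\<Prod>i\<in>moved N p. x (sorted_pair i (p i))) \<partial>gauss_pi ?I) = (\<Prod>z\<in>?I. std_moment (k z))"
    unfolding eq by (rule gauss_pi_monomial(2)) simp
  have inj: "p i = p j \<longleftrightarrow> i = j" for i j using permutes_inj[OF p] by (auto simp: inj_eq)
  show ?thesis
  proof (cases "\<forall>i. p (p i) = i")
    case True
    have "std_moment (k z) = 1" if "z \<in> ?I" for z
    proof (cases "{i\<in>moved N p. sorted_pair i (p i) = z} = {}")
      case True
      then show ?thesis unfolding k_def by (metis card.empty std_moment_simps(1))
    next
      case False
      then obtain i where i: "i \<in> moved N p" "sorted_pair i (p i) = z" by auto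
      then have "{j\<in>moved N p. sorted_pair j (p j) = z} = {i, p i}"
        using True pN by (auto simp: moved_def sorted_pair_eq_iff)
      moreover have "i \<noteq> p i" using i by (auto simp: moved_def)
      ultimately show ?thesis by (simp add: k_def)
    qed
    then show ?thesis unfolding val using True by (simp add: prod.neutral)
  next
    case False
    then obtain i where i: "p (p i) \<noteq> i" by auto
    have "i \<in> moved N p"
      using i permutes_not_in[OF p, of i] unfolding moved_def by (cases "i < N") auto
    then have "{j\<in>moved N p. sorted_pair j (p j) = sorted_pair i (p i)} = {i}"
      using i by (auto simp: sorted_pair_eq_iff inj)
    then have "k (sorted_pair i (p i)) = 1" by (simp add: k_def)
    moreover have "sorted_pair i (p i) \<in> ?I"
      using \<open>i \<in> moved N p\<close> by (auto simp: moved_def intro!: sorted_pair_in_gauss_idx pN)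
    ultimately have zero: "(\<Prod>z\<in>?I. std_moment (k z)) = 0"
      by (intro prod_zero) (auto intro!: bexI[of _ "sorted_pair i (p i)"])
    have "of_bool (\<forall>i. p (p i) = i) = (0::real)" using False by simp
    then show ?thesis by (simp only: val zero)
  qed
qed

text \<open>In each Leibniz term a fixed point contributes exactly \<open>s\<close>, because
  \<open>A\<close> has zero diagonal, and a moved point contributes one random entry. The
  expectation of the product of these variables is 1 for involutions and 0 otherwise.\<close>

lemma expectation_fdet_involutions:
  fixes A :: "nat \<Rightarrow> nat \<Rightarrow> real"
  assumes A0: "\<And>i. A i i = 0"
  shows "(\<integral>x. fdet N (\<lambda>i k. (if i = k then s else 0) + A i k * x (sorted_pair i k)) \<partial>gauss_pi (gauss_idx N))
    = (\<Sum>p\<in>{p. p permutes {0..<N} \<and> (\<forall>i. p (p i) = i)}.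
        of_int (sign p) * (s ^ (N - card (moved N p)) * (\<Prod>i\<in>moved N p. A i (p i))))"
proof -
  let ?I = "gauss_idx N"
  interpret prob_space "gauss_pi ?I" by (rule prob_space_gauss_pi)
  have tm: "(\<Prod>i=0..<N. (if i = p i then s else 0) + A i (p i) * x (sorted_pair i (p i)))
    = s ^ (N - card (moved N p)) * (\<Prod>i\<in>moved N p. A i (p i)) * (\<Prod>i\<in>moved N p. x (sorted_pair i (p i)))" for p x
  proof -
    have sub: "moved N p \<subseteq> {0..<N}" by (auto simp: moved_def)
    have "(\<Prod>i=0..<N. (if i = p i then s else 0) + A i (p i) * x (sorted_pair i (p i)))
      = (\<Prod>i\<in>{0..<N} - moved N p. (if i = p i then s else 0) + A i (p i) * x (sorted_pair i (p i)))
       * (\<Prod>i\<in>moved N p. (if i = p i then s else 0) + A i (p i) * x (sorted_pair i (p i)))"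
      by (rule prod.subset_diff[OF sub]) simp
    also have "(\<Prod>i\<in>{0..<N} - moved N p. (if i = p i then s else 0) + A i (p i) * x (sorted_pair i (p i)))
        = (\<Prod>i\<in>{0..<N} - moved N p. s)"
      by (intro prod.cong refl) (auto simp: moved_def A0)
    also have "\<dots> = s ^ (N - card (moved N p))"
      using card_Diff_subset[OF finite_subset[OF sub] sub] by simp
    also have "(\<Prod>i\<in>moved N p. (if i = p i then s else 0) + A i (p i) * x (sorted_pair i (p i)))
        = (\<Prod>i\<in>moved N p. A i (p i)) * (\<Prod>i\<in>moved N p. x (sorted_pair i (p i)))"
      unfolding prod.distrib[symmetric] by (intro prod.cong refl) (auto simp: moved_def)
    finally show ?thesis by simp
  qed
  have int: "integrable (gauss_pi ?I) (\<lambda>x. \<Prod>i\<in>moved N p. x (sorted_pair i (p i)))" if "p permutes {0..<N}" for p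
  proof (intro has_moments_integrable has_moments_prod gauss_pi_has_moments)
    fix i assume "i \<in> moved N p"
    then show "sorted_pair i (p i) \<in> ?I"
      using permutes_in_image[OF that, of i] by (auto simp: moved_def intro!: sorted_pair_in_gauss_idx)
  qed
  have "expectation (\<lambda>x. fdet N (\<lambda>i k. (if i = k then s else 0) + A i k * x (sorted_pair i k)))
    = (\<Sum>p\<in>{p. p permutes {0..<N}}. expectation (\<lambda>x. of_int (sign p) *
        (s ^ (N - card (moved N p)) * (\<Prod>i\<in>moved N p. A i (p i)) * (\<Prod>i\<in>moved N p. x (sorted_pair i (p i))))))"
    unfolding fdet_leibniz tm
    by (rule Bochner_Integration.integral_sum) (auto intro!: integrable_mult_right int)
  also have "\<dots> = (\<Sum>p\<in>{p. p permutes {0..<N}}. of_int (sign p) *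
        (s ^ (N - card (moved N p)) * (\<Prod>i\<in>moved N p. A i (p i))) * of_bool (\<forall>i. p (p i) = i))"
    by (intro sum.cong refl) (simp add: expectation_perm_term)
  also have "\<dots> = (\<Sum>p\<in>{p. p permutes {0..<N} \<and> (\<forall>i. p (p i) = i)}.
        of_int (sign p) * (s ^ (N - card (moved N p)) * (\<Prod>i\<in>moved N p. A i (p i))))"
    by (rule sum.mono_neutral_cong_right) (auto simp: finite_permutations)
  finally show ?thesis .
qed

section \<open>The correspondence between matchings and involutions\<close>

definition all_matchings :: "'v set set \<Rightarrow> 'v set set set" where
  "all_matchings E = (\<Union>k. matchings E k)"

lemma all_matchings_iff: "M \<in> all_matchings E \<longleftrightarrow> M \<subseteq> E \<and> finite M \<and> (\<forall>e1\<in>M. \<forall>e2\<in>M. e1 \<noteq> e2 \<longrightarrow> e1 \<inter> e2 = {})"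
  by (auto simp: all_matchings_def matchings_def)

text \<open>The involution is the product of the transpositions of the edges, built one edge at a
  time. A new edge \<open>{u, v}\<close> meets no earlier one, so it flips the sign, adds two moved
  points and multiplies the product by \<open>A u v * A v u = - w e\<close>.\<close>

lemma matching_involution:
  fixes A :: "nat \<Rightarrow> nat \<Rightarrow> real"
  assumes E: "\<And>e. e \<in> E \<Longrightarrow> \<exists>i k. i < N \<and> k < N \<and> i \<noteq> k \<and> e = {i, k}"
    and w: "\<And>i k. {i, k} \<in> E \<Longrightarrow> i \<noteq> k \<Longrightarrow> A i k * A k i = - w {i, k}"
    and M: "finite M" "M \<in> all_matchings E"
  shows "\<exists>p. p permutes {0..<N} \<and> (\<forall>i. p (p i) = i) \<and> perm_edges N p = M \<and> sign p = (-1) ^ card M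
    \<and> card (moved N p) = 2 * card M \<and> (\<Prod>i\<in>moved N p. A i (p i)) = (\<Prod>e\<in>M. - w e)"
  using M
proof (induction M)
  case empty
  show ?case by (rule exI[of _ id]) (auto simp: perm_edges_def moved_def permutes_id[unfolded id_def])
next
  case (insert e M)
  then have "M \<in> all_matchings E" and disj: "\<And>e'. e' \<in> M \<Longrightarrow> e \<inter> e' = {}" and eE: "e \<in> E"
    by (auto simp: all_matchings_iff)
  from insert.IH[OF this(1)] obtain p where p: "p permutes {0..<N}" "\<And>i. p (p i) = i" "perm_edges N p = M"
     "sign p = (-1) ^ card M" "card (moved N p) = 2 * card M" "(\<Prod>i\<in>moved N p. A i (p i)) = (\<Prod>e\<in>M. - w e)"
    by blast
  obtain u v where uv: "u < N" "v < N" "u \<noteq> v" "e = {u, v}" using E[OF eE] by blast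
  have "i \<notin> moved N p" if "i \<in> e" for i
  proof
    assume "i \<in> moved N p"
    then have "{i, p i} \<in> M" using p(3) by (auto simp: perm_edges_def)
    from disj[OF this] that show False by auto
  qed
  then have pu: "p u = u" and pv: "p v = v" and nm: "u \<notin> moved N p" "v \<notin> moved N p"
    using uv by (auto simp: moved_def)
  have inj: "p i = p j \<longleftrightarrow> i = j" for i j using permutes_inj[OF p(1)] by (auto simp: inj_eq)
  have ne: "p i \<noteq> u" "p i \<noteq> v" if "i \<noteq> u" "i \<noteq> v" for i
    using that inj[of i u] inj[of i v] pu pv by auto
  define p' where "p' = Transposition.transpose u v \<circ> p"
  have p': "p' u = v" "p' v = u" "\<And>i. i \<noteq> u \<Longrightarrow> i \<noteq> v \<Longrightarrow> p' i = p i"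
    using pu pv ne by (auto simp: p'_def Transposition.transpose_def)
  have mv: "moved N p' = {u, v} \<union> moved N p"
  proof (intro Set.set_eqI iffI)
    fix i assume "i \<in> moved N p'" then show "i \<in> {u, v} \<union> moved N p"
      using p'(3)[of i] by (cases "i = u \<or> i = v") (auto simp: moved_def)
  next
    fix i assume "i \<in> {u, v} \<union> moved N p" then show "i \<in> moved N p'"
      using p' uv nm by (cases "i = u \<or> i = v") (auto simp: moved_def)
  qed
  have fin: "finite (moved N p)" by (simp add: moved_def)
  have 1: "p' permutes {0..<N}"
    unfolding p'_def using uv by (intro permutes_compose[OF p(1)] permutes_swap_id) auto
  have 2: "p' (p' i) = i" for i
  proof (cases "i = u \<or> i = v")
    case True
    then show ?thesis using p'(1,2) by auto
  next
    case False
    then show ?thesis using p'(3)[of i] p'(3)[of "p i"] ne[of i] p(2)[of i] by metis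
  qed
  have same: "p' i = p i" if "i \<in> moved N p" for i using p'(3)[of i] nm that by auto
  have 3: "perm_edges N p' = insert e M"
    unfolding perm_edges_def mv image_Un p(3)[symmetric] using p' uv same by (auto simp: insert_commute)
  have 4: "sign p' = (-1) ^ card (insert e M)"
  proof -
    have "permutation p" using p(1) by (auto simp: permutation_permutes)
    then show ?thesis unfolding p'_def using uv p(4) insert.hyps
      by (simp add: sign_compose permutation_swap_id sign_swap_id)
  qed
  have 5: "card (moved N p') = 2 * card (insert e M)"
    unfolding mv using fin nm uv p(5) insert.hyps by simp
  have "(\<Prod>i\<in>moved N p'. A i (p' i)) = A u v * (A v u * (\<Prod>i\<in>moved N p. A i (p' i)))"
    unfolding mv using fin nm uv p' by simp
  also have "(\<Prod>i\<in>moved N p. A i (p' i)) = (\<Prod>i\<in>moved N p. A i (p i))"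
    by (intro prod.cong refl) (simp add: same)
  also have "A u v * (A v u * (\<Prod>i\<in>moved N p. A i (p i))) = - w e * (\<Prod>e\<in>M. - w e)"
  proof -
    have "A u v * A v u = - w e" using w[of u v] eE uv by simp
    then show ?thesis by (simp only: p(6) mult.assoc[symmetric])
  qed
  also have "\<dots> = (\<Prod>e\<in>insert e M. - w e)" using insert.hyps by (subst prod.insert) auto
  finally show ?case using 1 2 3 4 5 by blast
qed

lemma perm_edges_matching:
  assumes p: "p permutes {0..<N}" "\<And>i. p (p i) = i" and E: "perm_edges N p \<subseteq> E"
  shows "perm_edges N p \<in> all_matchings E"
proof -
  have inj: "p i = p j \<longleftrightarrow> i = j" for i j using permutes_inj[OF p(1)] by (auto simp: inj_eq)
  have "{i, p i} = {j, p j}" if "{i, p i} \<inter> {j, p j} \<noteq> {}" for i j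
  proof -
    from that have "i = j \<or> i = p j \<or> p i = j \<or> p i = p j" by auto
    then show ?thesis using p(2) inj by (metis doubleton_eq_iff)
  qed
  then show ?thesis using E unfolding all_matchings_iff
    by (auto simp: perm_edges_def moved_def simp del: doubleton_eq_iff)
qed

lemma perm_edges_inj:
  assumes p: "p permutes {0..<N}" and p': "p' permutes {0..<N}" "\<And>i. p' (p' i) = i"
    and eq: "perm_edges N p = perm_edges N p'"
  shows "p i = i \<or> p i = p' i"
proof (cases "i \<in> moved N p")
  case True
  then have "{i, p i} \<in> perm_edges N p'" using eq by (auto simp: perm_edges_def)
  then obtain j where "{i, p i} = {j, p' j}" by (auto simp: perm_edges_def)
  then show ?thesis using p'(2)[of j] by (auto simp: doubleton_eq_iff)
next
  case False
  then show ?thesis using permutes_not_in[OF p, of i] by (cases "i < N") (auto simp: moved_def)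
qed

text \<open>Involutions with all edges in \<open>E\<close> correspond bijectively to matchings, and
  any other involution meets a zero of \<open>A\<close>. The sign \<open>(-1) ^ card M\<close> of
  the involution cancels against the product of the \<open>- w e\<close>.\<close>

lemma expectation_fdet_matchings:
  fixes A :: "nat \<Rightarrow> nat \<Rightarrow> real"
  assumes E: "\<And>e. e \<in> E \<Longrightarrow> \<exists>i k. i < N \<and> k < N \<and> i \<noteq> k \<and> e = {i, k}"
    and w: "\<And>i k. {i, k} \<in> E \<Longrightarrow> i \<noteq> k \<Longrightarrow> A i k * A k i = - w {i, k}"
    and A0: "\<And>i. A i i = 0" and nE: "\<And>i k. i < N \<Longrightarrow> k < N \<Longrightarrow> {i, k} \<notin> E \<Longrightarrow> A i k = 0"
  shows "(\<integral>x. fdet N (\<lambda>i k. (if i = k then s else 0) + A i k * x (sorted_pair i k)) \<partial>gauss_pi (gauss_idx N))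
    = (\<Sum>M\<in>all_matchings E. s ^ (N - 2 * card M) * (\<Prod>e\<in>M. w e))"
    and "M \<in> all_matchings E \<Longrightarrow> 2 * card M \<le> N"
    and "finite E"
proof -
  let ?P = "{p. p permutes {0..<N} \<and> (\<forall>i. p (p i) = i)}"
  let ?PE = "{p\<in>?P. perm_edges N p \<subseteq> E}"
  let ?t = "\<lambda>p. of_int (sign p) * (s ^ (N - card (moved N p)) * (\<Prod>i\<in>moved N p. A i (p i)))"
  have inv: "\<exists>p. p permutes {0..<N} \<and> (\<forall>i. p (p i) = i) \<and> perm_edges N p = M \<and> sign p = (-1) ^ card M
    \<and> card (moved N p) = 2 * card M \<and> (\<Prod>i\<in>moved N p. A i (p i)) = (\<Prod>e\<in>M. - w e)" if "M \<in> all_matchings E" for M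
    using that by (intro matching_involution[where E = E] E w) (auto simp: all_matchings_iff)
  have inj: "p = p'" if "p \<in> ?P" "p' \<in> ?P" "perm_edges N p = perm_edges N p'" for p p'
  proof
    fix i show "p i = p' i"
      \<comment> \<open>Used in both directions: if neither gives \<open>p i = p' i\<close>, then
        both permutations fix \<open>i\<close>.\<close>
      using perm_edges_inj[of p N p' i] perm_edges_inj[of p' N p i] that by auto
  qed
  show "2 * card M \<le> N" if M: "M \<in> all_matchings E" for M
  proof -
    obtain p where "card (moved N p) = 2 * card M" using inv[OF M] by blast
    moreover have "card (moved N p) \<le> card {0..<N}" by (rule card_mono) (auto simp: moved_def)
    ultimately show ?thesis by simp
  qed
  have "E \<subseteq> Pow {..<N}" using E by fastforce
  then show "finite E" by (rule finite_subset) simp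
  have "(\<Sum>p\<in>?P. ?t p) = (\<Sum>p\<in>?PE. ?t p)"
  proof (rule sum.mono_neutral_right)
    show "finite ?P" by (rule finite_subset[of _ "{p. p permutes {0..<N}}"]) (auto simp: finite_permutations)
    show "\<forall>p\<in>?P - ?PE. ?t p = 0"
    proof
      fix p assume p: "p \<in> ?P - ?PE"
      then obtain i where i: "i \<in> moved N p" "{i, p i} \<notin> E" by (auto simp: perm_edges_def)
      then have "A i (p i) = 0"
        using p permutes_in_image[of p "{0..<N}" i] by (intro nE) (auto simp: moved_def)
      then have "(\<Prod>i\<in>moved N p. A i (p i)) = 0"
        using i by (intro prod_zero) (auto simp: moved_def)
      then show "?t p = 0" by simp
    qed
  qed auto
  also have "\<dots> = (\<Sum>M\<in>all_matchings E. s ^ (N - 2 * card M) * (\<Prod>e\<in>M. w e))"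
  proof (rule sum.reindex_cong[symmetric])
    show "inj_on (perm_edges N) ?PE" using inj by (auto simp: inj_on_def)
    show "all_matchings E = perm_edges N ` ?PE"
    proof (intro Set.set_eqI iffI)
      fix M assume "M \<in> all_matchings E"
      then have "M \<subseteq> E" by (simp add: all_matchings_iff)
      with inv[OF \<open>M \<in> all_matchings E\<close>] show "M \<in> perm_edges N ` ?PE" by blast
    qed (auto intro!: perm_edges_matching)
    fix p assume p: "p \<in> ?PE"
    then have "perm_edges N p \<in> all_matchings E" by (auto intro!: perm_edges_matching)
    from inv[OF this] obtain p' where p': "p' \<in> ?P" "perm_edges N p' = perm_edges N p"
      "sign p' = (-1) ^ card (perm_edges N p)" "card (moved N p') = 2 * card (perm_edges N p)"
      "(\<Prod>i\<in>moved N p'. A i (p' i)) = (\<Prod>e\<in>perm_edges N p. - w e)" by blast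
    have "p' = p" using inj[OF p'(1) _ p'(2)] p by blast
    then show "s ^ (N - 2 * card (perm_edges N p)) * (\<Prod>e\<in>perm_edges N p. w e) = ?t p"
    proof -
      define c where "c = card (perm_edges N p)"
      have "(\<Prod>e\<in>perm_edges N p. - w e) = (-1) ^ c * (\<Prod>e\<in>perm_edges N p. w e)"
        unfolding c_def by (simp add: prod_uminus)
      moreover have "((-1) ^ c * (-1) ^ c :: real) = 1" by (simp flip: power_mult_distrib)
      moreover have "?t p = of_int ((-1) ^ c) * (s ^ (N - 2 * c) * (\<Prod>e\<in>perm_edges N p. - w e))"
        using p' unfolding \<open>p' = p\<close> c_def by simp
      ultimately show ?thesis unfolding c_def[symmetric]
        by (simp add: mult.left_commute[of "s ^ (N - 2 * c)"] mult.assoc[symmetric])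
    qed
  qed
  finally show "(\<integral>x. fdet N (\<lambda>i k. (if i = k then s else 0) + A i k * x (sorted_pair i k)) \<partial>gauss_pi (gauss_idx N))
    = (\<Sum>M\<in>all_matchings E. s ^ (N - 2 * card M) * (\<Prod>e\<in>M. w e))"
    unfolding expectation_fdet_involutions[OF A0] .
qed

section \<open>Concentration\<close>

text \<open>Connects the full family of \<open>N * (N + 1) / 2\<close> variables with the
  \<open>m * n\<close> of them that enter the Gram matrix.\<close>

lemma gauss_pi_restrict:
  assumes JI: "J \<subseteq> I" "finite I" and F: "F \<in> borel_measurable (gauss_pi J)" "\<And>x. F (restrict x J) = (F x :: real)"
  shows "(\<integral>x. F x \<partial>gauss_pi I) = (\<integral>x. F x \<partial>gauss_pi J)"
proof -
  interpret product_prob_space "\<lambda>_. density lborel std_normal_density" I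
    by (simp add: product_prob_space_def product_prob_space_axioms_def product_sigma_finite_def
        prob_space_std_normal prob_space_imp_sigma_finite[OF prob_space_std_normal])
  have "(\<integral>x. F x \<partial>gauss_pi J) = (\<integral>x. F x \<partial>distr (gauss_pi I) (gauss_pi J) (\<lambda>f. restrict f J))"
    unfolding gauss_pi_def using distr_restrict[OF JI] by simp
  also have "\<dots> = (\<integral>x. F (restrict x J) \<partial>gauss_pi I)"
    using F(1) unfolding gauss_pi_def by (intro integral_distr measurable_restrict_subset JI)
  finally show ?thesis by (simp add: F(2))
qed

lemma gauss_space_eq: "gauss_space N = gauss_pi (gauss_idx N)"
  by (simp add: gauss_space_def gauss_pi_def)

text \<open>The standard deviation of the entry in row \<open>i\<close> and vertex column
  \<open>j\<close>, both counted from 0 while \<open>\<omega>\<close> counts from 1; hence the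
  shifts.\<close>

definition edge_sd :: "nat \<Rightarrow> (nat \<Rightarrow> nat \<Rightarrow> real) \<Rightarrow> nat \<Rightarrow> nat \<Rightarrow> real" where
  "edge_sd m \<omega> i j = sqrt (\<omega> (i + 1) (j + 1 - m))"

lemma det_random_matrix:
  assumes "m \<le> n" "0 < s"
  shows "Determinant.det (s \<cdot>\<^sub>m 1\<^sub>m (m + n) + Y_mat (A_mat m n \<omega>) x)
      = fdet (m + n) (\<lambda>i k. (if i = k then s else 0) + A_entry m \<omega> i k * x (sorted_pair i k))" (is "?D = ?F")
    and "Determinant.det (s \<cdot>\<^sub>m 1\<^sub>m (m + n) + Y_mat (A_mat m n \<omega>) x)
      = s ^ (n - m) * fdet m (gram (sdiag (s\<^sup>2)) (edge_sd m \<omega>) {m..<m+n} x)"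
proof -
  show 1: "?D = ?F"
    unfolding fdet_def by (rule arg_cong[where f=Determinant.det], rule eq_matI)
      (auto simp: Y_mat_def A_mat_def sorted_pair_def)
  define B where "B i k = gcol (edge_sd m \<omega>) k x i" for i k
  have "?F = Determinant.det (mat (m + n) (m + n) (\<lambda>(i, k).
      if i = k then s else if i < m \<and> m \<le> k then B i k else if k < m \<and> m \<le> i then - B k i else 0))"
    unfolding fdet_def
    by (rule arg_cong[where f=Determinant.det], rule eq_matI)
       (auto simp: A_entry_def B_def gcol_def edge_sd_def sorted_pair_def min_def max_def)
  then have "s ^ m * ?F = s ^ n * fdet m (gram (sdiag (s\<^sup>2)) (edge_sd m \<omega>) {m..<m+n} x)"
    using det_bipartite_block[of s m n B]
    unfolding fdet_def gram_def sdiag_def B_def by simp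
  also have "s ^ n = s ^ m * s ^ (n - m)" using assms by (simp flip: power_add)
  finally have "s ^ m * ?F = s ^ m * (s ^ (n - m) * fdet m (gram (sdiag (s\<^sup>2)) (edge_sd m \<omega>) {m..<m+n} x))"
    by (simp only: mult.assoc)
  then show "?D = s ^ (n - m) * fdet m (gram (sdiag (s\<^sup>2)) (edge_sd m \<omega>) {m..<m+n} x)"
    using assms unfolding 1 by simp
qed

section \<open>The matching polynomial of the complete bipartite graph\<close>

lemma Kmn_E_iff:
  assumes "i < k"
  shows "{i, k} \<in> Kmn_E m n \<longleftrightarrow> i < m \<and> m \<le> k \<and> k < m + n"
proof
  assume "{i, k} \<in> Kmn_E m n"
  then obtain i' j' where *: "{i, k} = {i' - 1, m + j' - 1}" "1 \<le> i'" "i' \<le> m" "1 \<le> j'" "j' \<le> n"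
    by (auto simp: Kmn_E_def)
  then have "i = i' - 1 \<and> k = m + j' - 1"
    using assms by (auto simp: doubleton_eq_iff)
  then show "i < m \<and> m \<le> k \<and> k < m + n" using * by auto
next
  assume *: "i < m \<and> m \<le> k \<and> k < m + n"
  then show "{i, k} \<in> Kmn_E m n"
    unfolding Kmn_E_def by (intro CollectI exI[of _ "i + 1"] exI[of _ "k + 1 - m"]) auto
qed

text \<open>A \<open>k\<close>-matching leaves \<open>N - 2 * k\<close> fixed points, while
  \<open>Phi_K\<close> at \<open>s\<^sup>2\<close> has the power
  \<open>s ^ (2 * (N div 2 - k))\<close>. The difference is the parity factor
  \<open>s ^ (N mod 2)\<close>.\<close>

lemma expectation_det_eq_Phi:
  assumes \<omega>: "weights_in m n (b\<^sup>2) c \<omega>" and s: "0 < s"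
  defines "N \<equiv> m + n"
  shows "(\<integral>x. fdet N (\<lambda>i k. (if i = k then s else 0) + A_entry m \<omega> i k * x (sorted_pair i k)) \<partial>gauss_space N)
    = s ^ (N mod 2) * Phi_K m n \<omega> (s\<^sup>2)"
proof -
  let ?E = "Kmn_E m n" and ?w = "Kmn_w m \<omega>"
  have sub: "\<exists>i k. i < N \<and> k < N \<and> i \<noteq> k \<and> e = {i, k}" if "e \<in> ?E" for e
  proof -
    from that obtain i j where "e = {i - 1, m + j - 1}" "1 \<le> i" "i \<le> m" "1 \<le> j" "j \<le> n"
      by (auto simp: Kmn_E_def)
    then show ?thesis unfolding N_def by (intro exI[of _ "i - 1"] exI[of _ "m + j - 1"]) auto
  qed
  have w_lt: "A_entry m \<omega> i k * A_entry m \<omega> k i = - ?w {i, k}" if "{i, k} \<in> ?E" "i < k" for i k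
  proof -
    have ik: "i < m" "m \<le> k" "k < m + n" using that Kmn_E_iff by auto
    then have "i + 1 \<in> {1..m}" "k + 1 - m \<in> {1..n}" by auto
    then have "b\<^sup>2 \<le> \<omega> (i + 1) (k + 1 - m)" using \<omega> unfolding weights_in_def by (meson atLeastAtMost_iff)
    then have "0 \<le> \<omega> (i + 1) (k + 1 - m)" by (rule order_trans[OF zero_le_power2])
    moreover have "Min {i, k} = i" "Max {i, k} = k" using that(2) by auto
    ultimately show ?thesis using ik by (simp add: A_entry_def Kmn_w_def)
  qed
  have w: "A_entry m \<omega> i k * A_entry m \<omega> k i = - ?w {i, k}" if "{i, k} \<in> ?E" "i \<noteq> k" for i k
    using w_lt[of i k] w_lt[of k i] that by (cases "i < k") (auto simp: insert_commute mult.commute)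
  have A0: "A_entry m \<omega> i i = 0" for i by (simp add: A_entry_def)
  have nE: "A_entry m \<omega> i k = 0" if "i < N" "k < N" "{i, k} \<notin> ?E" for i k
  proof -
    consider "i = k" | "i < k" | "k < i" by linarith
    then show ?thesis
      using that Kmn_E_iff[of i k m n] Kmn_E_iff[of k i m n] unfolding N_def
      by cases (auto simp: A_entry_def insert_commute)
  qed
  note exp = expectation_fdet_matchings[of ?E N "A_entry m \<omega>" ?w, OF sub w A0 nE]
  have finE: "finite ?E" by (rule exp(3)) assumption+
  have fin: "finite (matchings ?E k)" for k
    by (rule finite_subset[of _ "Pow ?E"]) (auto simp: matchings_def finE)
  have card_le: "2 * card M \<le> N" if M: "M \<in> all_matchings ?E" for M
    by (rule exp(2)[OF _ _ _ _ _ _ M]) assumption+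
  have disj: "matchings ?E k \<inter> matchings ?E l = {}" if "k \<noteq> l" for k l
    using that by (auto simp: matchings_def)
  have un: "all_matchings ?E = (\<Union>k\<in>{0..N div 2}. matchings ?E k)"
  proof (intro Set.set_eqI iffI)
    fix M assume M: "M \<in> all_matchings ?E"
    then obtain k where "M \<in> matchings ?E k" by (auto simp: all_matchings_def)
    then show "M \<in> (\<Union>k\<in>{0..N div 2}. matchings ?E k)"
      using card_le[OF M] by (auto simp: matchings_def)
  qed (auto simp: all_matchings_def)
  have "(\<integral>x. fdet N (\<lambda>i k. (if i = k then s else 0) + A_entry m \<omega> i k * x (sorted_pair i k)) \<partial>gauss_space N)
    = (\<Sum>k=0..N div 2. \<Sum>M\<in>matchings ?E k. s ^ (N - 2 * card M) * (\<Prod>e\<in>M. ?w e))"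
    unfolding gauss_space_eq
  proof (rule trans[OF exp(1)])
    show "(\<Sum>M\<in>all_matchings ?E. s ^ (N - 2 * card M) * (\<Prod>e\<in>M. ?w e))
        = (\<Sum>k=0..N div 2. \<Sum>M\<in>matchings ?E k. s ^ (N - 2 * card M) * (\<Prod>e\<in>M. ?w e))"
      unfolding un by (rule sum.UNION_disjoint) (use fin disj in auto)
  qed
  also have "\<dots> = (\<Sum>k=0..N div 2. s ^ (N mod 2) * (match_phi ?E ?w k * (s\<^sup>2) ^ (N div 2 - k)))"
  proof (rule sum.cong[OF refl])
    fix k assume k: "k \<in> {0..N div 2}"
    have "N - 2 * k = N mod 2 + 2 * (N div 2 - k)" using k by (simp add: algebra_simps)
    then have pow: "s ^ (N - 2 * k) = s ^ (N mod 2) * (s\<^sup>2) ^ (N div 2 - k)"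
      by (simp only: power_add power_mult)
    have "(\<Sum>M\<in>matchings ?E k. s ^ (N - 2 * card M) * (\<Prod>e\<in>M. ?w e)) = (\<Sum>M\<in>matchings ?E k. s ^ (N - 2 * k) * (\<Prod>e\<in>M. ?w e))"
      by (intro sum.cong) (auto simp: matchings_def)
    then show "(\<Sum>M\<in>matchings ?E k. s ^ (N - 2 * card M) * (\<Prod>e\<in>M. ?w e)) = s ^ (N mod 2) * (match_phi ?E ?w k * (s\<^sup>2) ^ (N div 2 - k))"
      unfolding match_phi_def pow by (simp add: sum_distrib_left[symmetric] sum_distrib_right[symmetric] mult_ac)
  qed
  also have "\<dots> = s ^ (N mod 2) * Phi_K m n \<omega> (s\<^sup>2)"
    unfolding Phi_K_def match_Phi_def Kmn_V_def N_def by (simp add: sum_distrib_left)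
  finally show ?thesis .
qed

text \<open>With \<open>U = ln (E D) - ln D\<close> one has \<open>E (exp (- U)) = 1\<close>, and \<open>\<bar>U\<bar> \<le> U + 2 exp (- U)\<close>; so a bound on
  the gap \<open>E U\<close> alone controls \<open>U\<close> in mean.\<close>

lemma (in prob_space) ln_deviation_le:
  fixes D :: "'a \<Rightarrow> real"
  assumes D: "integrable M D" "\<And>x. 0 < D x" and lnD: "integrable M (\<lambda>x. ln (D x))"
    and pos: "0 < expectation D" and gap: "ln (expectation D) \<le> expectation (\<lambda>x. ln (D x)) + B"
  shows "expectation (\<lambda>x. \<bar>ln (D x) - ln (expectation D)\<bar>) \<le> B + 2"
proof -
  have "expectation (\<lambda>x. \<bar>ln (D x) - ln (expectation D)\<bar>)
    \<le> expectation (\<lambda>x. (ln (expectation D) - ln (D x)) + 2 * (D x / expectation D))"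
  proof (rule integral_mono)
    show "integrable M (\<lambda>x. \<bar>ln (D x) - ln (expectation D)\<bar>)" using lnD by simp
    show "integrable M (\<lambda>x. (ln (expectation D) - ln (D x)) + 2 * (D x / expectation D))"
      using lnD D(1) by simp
    fix x
    define u where "u = ln (D x) - ln (expectation D)"
    have "exp u = D x / expectation D" using D(2)[of x] pos by (simp add: u_def exp_diff)
    moreover have "\<bar>u\<bar> \<le> - u + 2 * exp u" using exp_ge_add_one_self[of u] exp_gt_zero[of u] by linarith
    ultimately show "\<bar>ln (D x) - ln (expectation D)\<bar> \<le> (ln (expectation D) - ln (D x)) + 2 * (D x / expectation D)"
      unfolding u_def by simp
  qed
  also have "\<dots> = ln (expectation D) - expectation (\<lambda>x. ln (D x)) + 2"
    using lnD D(1) pos by (simp add: prob_space)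
  finally show ?thesis using gap by simp
qed

text \<open>The gap of \<open>Z\<close> is also the gap of \<open>D\<close>, because
  \<open>s ^ (n - m)\<close> is deterministic. The summand 2 is the price of absolute values in
  \<open>ln_deviation_le\<close>, and \<open>ln (sqrt t)\<close> accounts for the parity factor
  between the expected determinant and \<open>Phi_K\<close>.\<close>

lemma logdet_deviation:
  assumes b: "0 < b" "b \<le> a" and t: "0 < t" "t \<le> T" and mn: "1 \<le> m" "m \<le> n"
    and \<omega>: "weights_in m n (b\<^sup>2) (a\<^sup>2) \<omega>"
  defines "B \<equiv> 2 * (a\<^sup>2 / T) * n + (T - t) * (((1 + 2 * (a\<^sup>2 / t)) / (t * b\<^sup>2) + 1) / 2 * sqrt n)"
  shows "integrable (gauss_space (m + n)) (logdet_rand m n \<omega> t)"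
    and "(\<integral>x. \<bar>logdet_rand m n \<omega> t x - ln (Phi_K m n \<omega> t)\<bar> \<partial>gauss_space (m + n)) \<le> B + 2 + \<bar>ln (sqrt t)\<bar>"
proof -
  define N where "N = m + n"
  define s where "s = sqrt t"
  define J where "J = {m..<m+n}"
  define \<sigma> where "\<sigma> = edge_sd m \<omega>"
  define Z where "Z x = fdet m (gram (sdiag t) \<sigma> J x)" for x
  define D where "D x = Determinant.det (s \<cdot>\<^sub>m 1\<^sub>m (m + n) + Y_mat (A_mat m n \<omega>) x)" for x
  let ?G = "gauss_space N"
  interpret prob_space ?G unfolding gauss_space_eq by (rule prob_space_gauss_pi)
  have s: "0 < s" "s\<^sup>2 = t" using t by (auto simp: s_def)
  have J: "finite J" "card J = n" by (auto simp: J_def)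
  have sub: "cells m J \<subseteq> gauss_idx N" by (auto simp: cells_def gauss_idx_def J_def N_def)
  have \<sigma>: "b \<le> \<sigma> i j \<and> \<sigma> i j \<le> a" if "i < m" "j \<in> J" for i j
  proof -
    have "i + 1 \<in> {1..m}" "j + 1 - m \<in> {1..n}" using that by (auto simp: J_def)
    then have "\<omega> (i + 1) (j + 1 - m) \<in> {b\<^sup>2..a\<^sup>2}"
      using \<omega> unfolding weights_in_def by meson
    then have "sqrt (b\<^sup>2) \<le> \<sigma> i j" "\<sigma> i j \<le> sqrt (a\<^sup>2)"
      unfolding \<sigma>_def edge_sd_def by (intro real_sqrt_le_mono; simp)+
    then show ?thesis using b by simp
  qed
  have Dt: "pd_ge m t (sdiag t)" using pd_ge_diag[OF t(1)] by (simp add: sdiag_def[abs_def])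
  have Zpos: "0 < Z x" for x
    using pd_ge_gram(1)[OF J(1) Dt, of \<sigma> x] by (simp add: Z_def pd_ge_def)
  have D_Z: "D x = s ^ (n - m) * Z x" for x
    unfolding D_def Z_def J_def \<sigma>_def using det_random_matrix(2)[OF mn(2) s(1)] s(2) by simp
  have Dpos: "0 < D x" for x unfolding D_Z using Zpos s by simp
  have lnD_Z: "ln (D x) = ln (s ^ (n - m)) + ln (Z x)" for x
    unfolding D_Z using Zpos s by (simp add: ln_mult_pos)
  have logdet: "logdet_rand m n \<omega> t = (\<lambda>x. ln (D x))"
    by (simp add: logdet_rand_def D_def s_def fun_eq_iff)
  have intZ: "integrable ?G Z" unfolding gauss_space_eq Z_def
    by (rule has_moments_integrable[OF has_moments_fdet_gram[OF sub]])
  have intlnZ: "integrable ?G (\<lambda>x. ln (Z x))" unfolding gauss_space_eq Z_def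
    by (rule integrable_ln_fdet_gram[OF J(1) Dt sub])
  have intD: "integrable ?G D" unfolding D_Z[abs_def] using intZ by simp
  have intlnD: "integrable ?G (\<lambda>x. ln (D x))" unfolding lnD_Z using intlnZ by simp
  then show "integrable (gauss_space (m + n)) (logdet_rand m n \<omega> t)"
    unfolding logdet N_def .
  have res: "Z (restrict x (cells m J)) = Z x" for x
    unfolding Z_def by (rule fdet_cong) (simp add: gram_def gcol_def cells_def)
  have measZ: "Z \<in> borel_measurable (gauss_pi (cells m J))"
    unfolding Z_def[abs_def] by (rule has_moments_measurable[OF has_moments_fdet_gram[OF order_refl]])
  have EZ: "expectation Z = (\<integral>x. Z x \<partial>gauss_pi (cells m J))"
    unfolding gauss_space_eq by (rule gauss_pi_restrict[OF sub finite_gauss_idx measZ res])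
  have ElnZ: "expectation (\<lambda>x. ln (Z x)) = (\<integral>x. ln (Z x) \<partial>gauss_pi (cells m J))"
    unfolding gauss_space_eq
    by (rule gauss_pi_restrict[OF sub finite_gauss_idx borel_measurable_ln[OF measZ]]) (simp only: res)
  have "ln (expectation Z) \<le> expectation (\<lambda>x. ln (Z x)) + B"
    unfolding EZ ElnZ unfolding B_def Z_def
    using ln_expectation_gap[where \<sigma> = \<sigma> and J = J and m = m, OF J(1) t b(1) _ \<sigma>] J(2) mn by simp
  moreover have EZpos: "0 < expectation Z"
  proof -
    have "0 < fdet m (sdiag t)" using Dt by (simp add: pd_ge_def)
    also have "\<dots> = expectation (\<lambda>_. fdet m (sdiag t))" by (simp add: prob_space)
    also have "\<dots> \<le> expectation Z"
      unfolding Z_def[abs_def] by (rule integral_mono[OF _ intZ[unfolded Z_def[abs_def]] pd_ge_gram(2)[OF J(1) Dt]]) simp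
    finally show ?thesis .
  qed
  moreover have ED: "expectation D = s ^ (n - m) * expectation Z" unfolding D_Z[abs_def] by simp
  ultimately have gap: "ln (expectation D) \<le> expectation (\<lambda>x. ln (D x)) + B"
    unfolding lnD_Z using intlnZ s by (simp add: ln_mult_pos prob_space)
  have EDpos: "0 < expectation D" unfolding ED using EZpos s by simp
  have "expectation D = s ^ (N mod 2) * Phi_K m n \<omega> t"
    using expectation_det_eq_Phi[OF \<omega> s(1)] unfolding D_def det_random_matrix(1)[OF mn(2) s(1)] N_def s(2) .
  moreover from this have "0 < Phi_K m n \<omega> t" using EDpos s by (simp add: zero_less_mult_iff)
  ultimately have lnED: "ln (expectation D) = real (N mod 2) * ln s + ln (Phi_K m n \<omega> t)"
    using s by (simp add: ln_mult_pos ln_realpow)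
  have mod: "\<bar>real (N mod 2) * ln s\<bar> \<le> \<bar>ln s\<bar>"
    by (cases "even N") (auto simp: odd_iff_mod_2_eq_one)
  have "expectation (\<lambda>x. \<bar>ln (D x) - ln (Phi_K m n \<omega> t)\<bar>)
      \<le> expectation (\<lambda>x. \<bar>ln (D x) - ln (expectation D)\<bar> + \<bar>ln s\<bar>)"
  proof (rule integral_mono)
    fix x
    show "\<bar>ln (D x) - ln (Phi_K m n \<omega> t)\<bar> \<le> \<bar>ln (D x) - ln (expectation D)\<bar> + \<bar>ln s\<bar>"
      using mod lnED by linarith
  qed (use intlnD in auto)
  also have "\<dots> \<le> B + 2 + \<bar>ln s\<bar>"
    using ln_deviation_le[OF intD Dpos intlnD EDpos gap] intlnD by (simp add: prob_space)
  finally show "(\<integral>x. \<bar>logdet_rand m n \<omega> t x - ln (Phi_K m n \<omega> t)\<bar> \<partial>gauss_space (m + n)) \<le> B + 2 + \<bar>ln (sqrt t)\<bar>"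
    unfolding logdet N_def s_def .
qed

section \<open>Uniform estimates and the two limits\<close>

lemma logdet_deviation_uniform:
  assumes b: "0 < b" "b \<le> a" and t: "0 < t" and \<epsilon>: "0 < \<epsilon>"
  shows "\<forall>\<^sub>F n in sequentially. \<forall>m \<omega>. 1 \<le> m \<longrightarrow> m \<le> n \<longrightarrow> weights_in m n (b\<^sup>2) (a\<^sup>2) \<omega> \<longrightarrow>
    (\<integral>x. \<bar>logdet_rand m n \<omega> t x - ln (Phi_K m n \<omega> t)\<bar> \<partial>gauss_space (m + n)) \<le> \<epsilon> * real (m + n)"
proof -
  \<comment> \<open>Chosen so that \<open>2 * (a\<^sup>2 / T)\<close>, the coefficient of the only
    linear term of the bound, is at most \<open>\<epsilon> / 2\<close>. The remaining terms are of
    order \<open>sqrt n\<close> with \<open>T\<close> fixed and fit into the other half for large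
    \<open>n\<close>.\<close>
  define T where "T = t + 4 * a\<^sup>2 / \<epsilon>"
  define K where "K = ((1 + 2 * (a\<^sup>2 / t)) / (t * b\<^sup>2) + 1) / 2"
  define c where "c = 2 + \<bar>ln (sqrt t)\<bar>"
  have tT: "t \<le> T" using \<epsilon> by (simp add: T_def)
  have T: "0 < T" using t tT by simp
  have "2 * (a\<^sup>2 / T) \<le> \<epsilon> / 2"
  proof -
    have "4 * a\<^sup>2 \<le> \<epsilon> * T" using \<epsilon> t by (simp add: T_def distrib_left)
    then show ?thesis using T by (simp add: field_simps)
  qed
  then have lin: "2 * (a\<^sup>2 / T) * real n \<le> \<epsilon> / 2 * real n" for n by (rule mult_right_mono) simp
  have "(\<lambda>n. (T - t) * K * (1 / sqrt (real n)) + c * (1 / real n)) \<longlonglongrightarrow> (T - t) * K * 0 + c * 0"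
  proof (intro tendsto_add tendsto_mult tendsto_const)
    show "(\<lambda>n. 1 / real n) \<longlonglongrightarrow> 0" by (rule lim_1_over_n)
    then have "(\<lambda>n. sqrt (1 / real n)) \<longlonglongrightarrow> sqrt 0" by (rule tendsto_real_sqrt)
    then show "(\<lambda>n. 1 / sqrt (real n)) \<longlonglongrightarrow> 0" by (simp add: real_sqrt_divide)
  qed
  then have "\<forall>\<^sub>F n in sequentially. (T - t) * K * (1 / sqrt (real n)) + c * (1 / real n) < \<epsilon> / 2"
    using \<epsilon> by (intro order_tendstoD(2)) auto
  then show ?thesis
    using eventually_gt_at_top[of 0]
  proof eventually_elim
    case (elim n)
    show ?case
    proof (intro allI impI)
      fix m \<omega> assume *: "1 \<le> m" "m \<le> n" "weights_in m n (b\<^sup>2) (a\<^sup>2) \<omega>"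
      have n: "0 < real n" using elim(2) by simp
      have "((T - t) * K * (1 / sqrt (real n)) + c * (1 / real n)) * real n \<le> \<epsilon> / 2 * real n"
        using elim(1) by (intro mult_right_mono) auto
      moreover have "((T - t) * K * (1 / sqrt (real n)) + c * (1 / real n)) * real n = (T - t) * (K * sqrt n) + c"
      proof -
        have "1 / sqrt (real n) * real n = sqrt n" using real_div_sqrt[of "real n"] n by simp
        moreover have "((T - t) * K * (1 / sqrt (real n)) + c * (1 / real n)) * real n
            = (T - t) * (K * (1 / sqrt (real n) * real n)) + c * (1 / real n * real n)"
          by (simp only: distrib_right mult.assoc)
        ultimately show ?thesis using n by simp
      qed
      ultimately have small: "(T - t) * (K * sqrt n) + c \<le> \<epsilon> / 2 * real n" by simp
      have "(\<integral>x. \<bar>logdet_rand m n \<omega> t x - ln (Phi_K m n \<omega> t)\<bar> \<partial>gauss_space (m + n))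
        \<le> 2 * (a\<^sup>2 / T) * n + (T - t) * (K * sqrt n) + 2 + \<bar>ln (sqrt t)\<bar>"
        unfolding K_def by (rule logdet_deviation(2)[OF b t tT *])
      also have "\<dots> \<le> \<epsilon> * real n" using lin[of n] small unfolding c_def by linarith
      also have "\<dots> \<le> \<epsilon> * real (m + n)" using \<epsilon> by (intro mult_left_mono) auto
      finally show "(\<integral>x. \<bar>logdet_rand m n \<omega> t x - ln (Phi_K m n \<omega> t)\<bar> \<partial>gauss_space (m + n)) \<le> \<epsilon> * real (m + n)" .
    qed
  qed
qed

text \<open>The supremum is squeezed between \<open>- \<epsilon>\<close> and
  \<open>\<epsilon>\<close>, so the limsup is a limit. Nonemptiness gives the lower half: over an
  empty set the supremum is minus infinity.\<close>

lemma limsup_SUP_eq_0: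
  fixes f :: "nat \<Rightarrow> 'a \<Rightarrow> real"
  assumes ne: "\<forall>\<^sub>F n in sequentially. P n \<noteq> {}"
    and small: "\<And>\<epsilon>. 0 < \<epsilon> \<Longrightarrow> \<forall>\<^sub>F n in sequentially. \<forall>z\<in>P n. \<bar>f n z\<bar> \<le> \<epsilon>"
  shows "limsup (\<lambda>n. SUP z\<in>P n. ereal (f n z)) = 0"
proof (rule lim_imp_Limsup)
  have bounds: "\<forall>\<^sub>F n in sequentially. ereal (- \<epsilon>) \<le> (SUP z\<in>P n. ereal (f n z)) \<and> (SUP z\<in>P n. ereal (f n z)) \<le> ereal \<epsilon>"
    if "0 < \<epsilon>" for \<epsilon> :: real
    using ne small[OF that]
  proof eventually_elim
    case (elim n)
    then obtain z where z: "z \<in> P n" by auto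
    have "ereal (- \<epsilon>) \<le> ereal (f n z)" using elim(2) z by (auto simp: abs_le_iff)
    also have "\<dots> \<le> (SUP z\<in>P n. ereal (f n z))" using z by (rule SUP_upper)
    finally show ?case using elim(2) by (auto intro!: SUP_least simp: abs_le_iff)
  qed
  show "(\<lambda>n. SUP z\<in>P n. ereal (f n z)) \<longlonglongrightarrow> 0"
  proof (rule order_tendstoI)
    fix y :: ereal assume "y < 0"
    then obtain r where r: "y < ereal r" "ereal r < 0" using ereal_dense2 by blast
    then show "\<forall>\<^sub>F n in sequentially. y < (SUP z\<in>P n. ereal (f n z))"
      using bounds[of "- r"] by (auto elim!: eventually_mono intro: less_le_trans)
  next
    fix y :: ereal assume "0 < y"
    then obtain r where r: "0 < ereal r" "ereal r < y" using ereal_dense2 by blast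
    then show "\<forall>\<^sub>F n in sequentially. (SUP z\<in>P n. ereal (f n z)) < y"
      using bounds[of r] by (auto elim!: eventually_mono intro: le_less_trans)
  qed
qed simp

theorem theorem6p1:
  fixes a b t :: real
  assumes "0 < b" and "b \<le> a" and "0 < t"
  shows "(\<forall>\<delta>>0. limsup (\<lambda>n::nat.
            SUP (m, \<omega>) \<in> {(m, \<omega>). 1 \<le> m \<and> m \<le> n \<and> weights_in m n (b\<^sup>2) (a\<^sup>2) \<omega>}.
              ereal (measure (gauss_space (m + n))
                {x \<in> space (gauss_space (m + n)).
                   \<bar>logdet_rand m n \<omega> t x - ln (Phi_K m n \<omega> t)\<bar> / real (m + n) > \<delta>})) = 0)
       \<and> limsup (\<lambda>n::nat.
            SUP (m, \<omega>) \<in> {(m, \<omega>). 1 \<le> m \<and> m \<le> n \<and> weights_in m n (b\<^sup>2) (a\<^sup>2) \<omega>}.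
              ereal ((ln (Phi_K m n \<omega> t) - ln (Phi_tilde m n \<omega> t)) / real (m + n))) = 0"
proof -
  define P where "P n = {(m, \<omega>). 1 \<le> m \<and> m \<le> n \<and> weights_in m n (b\<^sup>2) (a\<^sup>2) \<omega>}" for n
  define X where "X n m \<omega> x = logdet_rand m n \<omega> t x - ln (Phi_K m n \<omega> t)" for n m \<omega> x
  have ne: "\<forall>\<^sub>F n in sequentially. P n \<noteq> {}"
    using eventually_ge_at_top[of 1]
  proof eventually_elim
    case (elim n)
    then have "(1, \<lambda>_ _. b\<^sup>2) \<in> P n" using assms by (simp add: P_def weights_in_def power_mono)
    then show ?case by blast
  qed
  have unif: "\<forall>\<^sub>F n in sequentially. \<forall>(m, \<omega>)\<in>P n. (\<integral>x. \<bar>X n m \<omega> x\<bar> \<partial>gauss_space (m + n)) \<le> \<epsilon> * real (m + n)"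
    if "0 < \<epsilon>" for \<epsilon>
    using logdet_deviation_uniform[OF assms that] unfolding P_def X_def by (auto elim!: eventually_mono)
  have int: "integrable (gauss_space (m + n)) (X n m \<omega>)" if "(m, \<omega>) \<in> P n" for n m \<omega>
  proof -
    interpret prob_space "gauss_space (m + n)" unfolding gauss_space_eq by (rule prob_space_gauss_pi)
    \<comment> \<open>Integrability does not depend on \<open>T\<close>, so
      \<open>order_refl\<close> takes \<open>T = t\<close>.\<close>
    show ?thesis unfolding X_def using that logdet_deviation(1)[OF assms order_refl, of m n \<omega>]
      by (auto simp: P_def)
  qed
  have "limsup (\<lambda>n. SUP z\<in>P n. ereal ((\<lambda>(m, \<omega>). measure (gauss_space (m + n))
      {x \<in> space (gauss_space (m + n)). \<bar>X n m \<omega> x\<bar> / real (m + n) > \<delta>}) z)) = 0" if \<delta>: "0 < \<delta>" for \<delta>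
  proof (rule limsup_SUP_eq_0[OF ne])
    fix \<epsilon> :: real assume "0 < \<epsilon>"
    \<comment> \<open>Markov's inequality at level \<open>\<delta> * (m + n)\<close> divides the
      mean by \<open>\<delta>\<close>, so the mean is required to be below
      \<open>\<epsilon> * \<delta> * (m + n)\<close>.\<close>
    then have "0 < \<epsilon> * \<delta>" using \<delta> by simp
    from unif[OF this] show "\<forall>\<^sub>F n in sequentially. \<forall>z\<in>P n. \<bar>(\<lambda>(m, \<omega>). measure (gauss_space (m + n))
      {x \<in> space (gauss_space (m + n)). \<bar>X n m \<omega> x\<bar> / real (m + n) > \<delta>}) z\<bar> \<le> \<epsilon>"
    proof (eventually_elim, safe)
      fix n m \<omega>
      assume *: "\<forall>(m, \<omega>)\<in>P n. (\<integral>x. \<bar>X n m \<omega> x\<bar> \<partial>gauss_space (m + n)) \<le> \<epsilon> * \<delta> * real (m + n)"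
        and P: "(m, \<omega>) \<in> P n"
      let ?G = "gauss_space (m + n)"
      interpret prob_space ?G unfolding gauss_space_eq by (rule prob_space_gauss_pi)
      have N: "0 < real (m + n)" using P by (simp add: P_def)
      have [measurable]: "X n m \<omega> \<in> borel_measurable ?G" using int[OF P] by simp
      have "prob {x \<in> space ?G. \<bar>X n m \<omega> x\<bar> / real (m + n) > \<delta>} \<le> prob {x \<in> space ?G. \<delta> * real (m + n) \<le> \<bar>X n m \<omega> x\<bar>}"
        using N by (intro finite_measure_mono) (auto simp: pos_less_divide_eq)
      also have "\<dots> \<le> (\<integral>x. \<bar>X n m \<omega> x\<bar> \<partial>?G) / (\<delta> * real (m + n))"
        using int[OF P] \<delta> N by (intro integral_Markov_inequality_measure[where A = "space ?G"]) auto
      also have "\<dots> \<le> (\<epsilon> * \<delta> * real (m + n)) / (\<delta> * real (m + n))"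
        using * P \<delta> N by (intro divide_right_mono) auto
      also have "\<dots> = \<epsilon>" using \<delta> N by simp
      finally show "\<bar>prob {x \<in> space ?G. \<bar>X n m \<omega> x\<bar> / real (m + n) > \<delta>}\<bar> \<le> \<epsilon>" by simp
    qed
  qed
  moreover have "limsup (\<lambda>n. SUP z\<in>P n. ereal ((\<lambda>(m, \<omega>). (ln (Phi_K m n \<omega> t) - ln (Phi_tilde m n \<omega> t)) / real (m + n)) z)) = 0"
  proof (rule limsup_SUP_eq_0[OF ne])
    fix \<epsilon> :: real assume "0 < \<epsilon>"
    from unif[OF this] show "\<forall>\<^sub>F n in sequentially. \<forall>z\<in>P n.
      \<bar>(\<lambda>(m, \<omega>). (ln (Phi_K m n \<omega> t) - ln (Phi_tilde m n \<omega> t)) / real (m + n)) z\<bar> \<le> \<epsilon>"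
    proof (eventually_elim, safe)
      fix n m \<omega>
      assume *: "\<forall>(m, \<omega>)\<in>P n. (\<integral>x. \<bar>X n m \<omega> x\<bar> \<partial>gauss_space (m + n)) \<le> \<epsilon> * real (m + n)"
        and P: "(m, \<omega>) \<in> P n"
      let ?G = "gauss_space (m + n)"
      interpret prob_space ?G unfolding gauss_space_eq by (rule prob_space_gauss_pi)
      have N: "0 < real (m + n)" using P by (simp add: P_def)
      have lg: "integrable ?G (logdet_rand m n \<omega> t)"
        using P logdet_deviation(1)[OF assms order_refl, of m n \<omega>] by (auto simp: P_def)
      \<comment> \<open>\<open>ln\<close> undoes the \<open>exp\<close> in \<open>Phi_tilde\<close>
        and leaves the expected log-determinant, so the second quantity is minus the mean of
        \<open>X\<close>, bounded by the mean of its absolute value.\<close>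
      have "expectation (X n m \<omega>) = ln (Phi_tilde m n \<omega> t) - ln (Phi_K m n \<omega> t)"
        unfolding X_def Phi_tilde_def using lg by (simp add: prob_space)
      then have "\<bar>ln (Phi_K m n \<omega> t) - ln (Phi_tilde m n \<omega> t)\<bar> \<le> expectation (\<lambda>x. \<bar>X n m \<omega> x\<bar>)"
        using integral_abs_bound[of ?G "X n m \<omega>"] by simp
      also have "\<dots> \<le> \<epsilon> * real (m + n)" using * P by auto
      finally show "\<bar>(ln (Phi_K m n \<omega> t) - ln (Phi_tilde m n \<omega> t)) / real (m + n)\<bar> \<le> \<epsilon>"
        using N by (simp add: abs_divide pos_divide_le_eq)
    qed
  qed
  ultimately show ?thesis
    unfolding P_def X_def by (simp add: case_prod_beta')
qed

end
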